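(* For each $1\le n\le\omega$ and every comeager set $C\subseteq X_n$, $F_n\le_B F_n\restriction C$.
   Context: Let $\mathbb N=\{0,1,2,\dots\}$ and identify $2^{\mathbb N}$ with $\mathcal P(\mathbb N)$. For $1\le m\le\omega$ and $x\in((2^{\mathbb N})^{\mathbb N})^m$ define recursively: $A^x_1=\{x(0)(k):k\in\mathbb N\}\subseteq 2^{\mathbb N}$; for $1\le j<m$ and $l\in\mathbb N$, $a^{x,l}_1=\{x(0)(k):x(1)(l)(k)=1\}$ and $a^{x,l}_{j}=\{a^{x,k}_{j-1}:x(j)(l)(k)=1\}$ for $j\ge 2$; and $A^x_{j+1}=\{a^{x,k}_j:k\in\mathbb N\}$ for $1\le j<m$. Let $X_1=(2^{\mathbb N})^{\mathbb N}$, and for $2\le n\le\omega$ let $X_n$ be the set of $x\in((2^{\mathbb N})^{\mathbb N})^n$ such that for every $1\le i<n$: (1) for every $m$ there is $k$ with $x(i)(k)(m)=1$; (2) for every $k$ there is $m$ with $x(i)(k)(m)=1$; (3) for all $k,l_1,l_2$, if $x(i-1)(l_1)=x(i-1)(l_2)$ then $x(i)(k)(l_1)=x(i)(k)(l_2)$. For $1\le n<\omega$, $F_n$ on $X_n$ is $x\mathrel{F_n}y\iff A^x_n=A^y_n$; $F_\omega$ on $X_\omega$ is $x\mathrel{F_\omega}y\iff A^x_j=A^y_j$ for all $1\le j<\omega$. *)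

theory Defs
  imports "HOL-Analysis.Analysis" "HOL-Library.Extended_Nat" "HOL-Library.Countable_Set_Type"
begin

text \<open>Points of 2^N are functions nat => bool (True = 1).  A point of
  ((2^N)^N)^n is a function x :: nat => nat => nat => bool, where x i k m = x(i)(k)(m);
  the index i ranges over {i. enat i < n} (extensional: undefined outside).\<close>

type_synonym pt = "nat \<Rightarrow> nat \<Rightarrow> nat \<Rightarrow> bool"

text \<open>Hereditarily countable sets over urelements from 2^N, used to express the
  sets A^x_j (which live at different set-theoretic levels) in a single type.\<close>
datatype hs = Atom "nat \<Rightarrow> bool" | HSet "hs cset"

fun aa :: "pt \<Rightarrow> nat \<Rightarrow> nat \<Rightarrow> hs" where
  "aa x 0 l = Atom (x 0 l)"
| "aa x (Suc j) l = HSet (acset {aa x j k | k. x (Suc j) l k})"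

text \<open>AA x (Suc j) = A^x_{j+1}, so AA x 1 = {x(0)(k) : k}.\<close>
definition AA :: "pt \<Rightarrow> nat \<Rightarrow> hs" where
  "AA x j = HSet (acset (range (aa x (j - 1))))"

definition cantor_top :: "(nat \<Rightarrow> bool) topology" where
  "cantor_top = product_topology (\<lambda>_. discrete_topology UNIV) UNIV"

definition seq_top :: "(nat \<Rightarrow> nat \<Rightarrow> bool) topology" where
  "seq_top = product_topology (\<lambda>_. cantor_top) UNIV"

definition ambient_top :: "enat \<Rightarrow> pt topology" where
  "ambient_top n = product_topology (\<lambda>_. seq_top) {i. enat i < n}"

definition Xset :: "enat \<Rightarrow> pt set" where
  "Xset n = {x \<in> topspace (ambient_top n).
     \<forall>i. 1 \<le> i \<and> enat i < n \<longrightarrow>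
        (\<forall>m. \<exists>k. x i k m) \<and>
        (\<forall>k. \<exists>m. x i k m) \<and>
        (\<forall>k l1 l2. x (i - 1) l1 = x (i - 1) l2 \<longrightarrow> x i k l1 = x i k l2)}"

definition Xtop :: "enat \<Rightarrow> pt topology" where
  "Xtop n = subtopology (ambient_top n) (Xset n)"

definition FF :: "enat \<Rightarrow> pt \<Rightarrow> pt \<Rightarrow> bool" where
  "FF n x y = (case n of enat m \<Rightarrow> AA x m = AA y m
                       | \<infinity> \<Rightarrow> (\<forall>j. 1 \<le> j \<longrightarrow> AA x j = AA y j))"

definition nowhere_dense_in :: "'a topology \<Rightarrow> 'a set \<Rightarrow> bool" where
  "nowhere_dense_in X N \<longleftrightarrow> N \<subseteq> topspace X \<and> X interior_of (X closure_of N) = {}"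

definition meager_in :: "'a topology \<Rightarrow> 'a set \<Rightarrow> bool" where
  "meager_in X M \<longleftrightarrow> M \<subseteq> topspace X \<and>
     (\<exists>N :: nat \<Rightarrow> 'a set. (\<forall>k. nowhere_dense_in X (N k)) \<and> M \<subseteq> (\<Union>k. N k))"

definition comeager_in :: "'a topology \<Rightarrow> 'a set \<Rightarrow> bool" where
  "comeager_in X C \<longleftrightarrow> C \<subseteq> topspace X \<and> meager_in X (topspace X - C)"

definition borel_sets_of :: "'a topology \<Rightarrow> 'a set set" where
  "borel_sets_of X = sigma_sets (topspace X) {U. openin X U}"

definition borel_map :: "'a topology \<Rightarrow> 'b topology \<Rightarrow> ('a \<Rightarrow> 'b) \<Rightarrow> bool" where
  "borel_map X Y f \<longleftrightarrow> f ` topspace X \<subseteq> topspace Y \<and>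
     (\<forall>U. openin Y U \<longrightarrow> {x \<in> topspace X. f x \<in> U} \<in> borel_sets_of X)"

definition borel_reducible ::
  "'a topology \<Rightarrow> ('a \<Rightarrow> 'a \<Rightarrow> bool) \<Rightarrow> 'b topology \<Rightarrow> ('b \<Rightarrow> 'b \<Rightarrow> bool) \<Rightarrow> bool" where
  "borel_reducible X E Y F \<longleftrightarrow> (\<exists>f. borel_map X Y f \<and>
     (\<forall>x\<in>topspace X. \<forall>y\<in>topspace X. E x y \<longleftrightarrow> F (f x) (f y)))"

end

theory Submission
  imports Defs
begin

text \<open>
  Every finite pattern of bits occurs in a point of \<open>Xset n\<close>, so a generic point is a sequence of
  generic reals (level 0) together with generic bipartite graphs between consecutive levels. Given
  \<open>x\<close>, such a structure is built invariantly from the sets coded by \<open>x\<close>: an element of level \<open>i\<close> is a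
  pair \<open>(F, c)\<close> of a finite list \<open>F\<close> of sets of level at most \<open>i\<close> and a code \<open>c\<close>. Whether two elements
  of consecutive levels are related depends only on their codes and on the equalities and memberships
  between their lists, and the codes are rich enough to realise every finite configuration. An
  element of level 0 is labelled by a point of a perfect set whose finite injective tuples are generic
  (Mycielski), with an initial segment prescribed by \<open>c\<close>. A greedy enumeration of this structure
  yields a point of \<open>C\<close>; taking least codes makes it Borel in \<open>x\<close>. Different elements have different
  neighbourhoods in the level below, so the hereditary sets coded by the new point determine, and are
  determined by, the sets of elements, hence those coded by \<open>x\<close>.
\<close>

section \<open>Mutually generic reals\<close>

text \<open>The requests in \<open>K\<close> are met one at a time. Meeting \<open>(j, ss)\<close>
  moves only nodes in \<open>ss\<close>, and only from bit \<open>m'\<close> on; earlier requests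
  see bits below \<open>m'\<close> only, so they stay met.\<close>

lemma fusion_step:
  fixes ar :: "nat \<Rightarrow> nat" and U :: "nat \<Rightarrow> (nat \<Rightarrow> nat \<Rightarrow> bool) \<Rightarrow> bool"
    and S :: "'a \<Rightarrow> nat \<Rightarrow> bool"
  assumes dense: "\<And>j q m. \<exists>q' m'. (\<forall>k<ar j. \<forall>b<m. q' k b = q k b) \<and>
      (\<forall>q''. (\<forall>k<ar j. \<forall>b<m'. q'' k b = q' k b) \<longrightarrow> U j q'')"
    and "finite K" and "\<And>j ss. (j, ss) \<in> K \<Longrightarrow> distinct ss \<and> length ss = ar j"
  shows "\<exists>S' m'. m \<le> m' \<and> (\<forall>\<sigma>. \<forall>b<m. S' \<sigma> b = S \<sigma> b) \<and>
     (\<forall>(j, ss) \<in> K. \<forall>q. (\<forall>k<ar j. \<forall>b<m'. q k b = S' (ss ! k) b) \<longrightarrow> U j q)"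
  using assms(2,3)
proof (induction K rule: finite_induct)
  case empty
  show ?case by auto
next
  case (insert t K)
  obtain j ss where t: "t = (j, ss)" by (cases t)
  have ss: "distinct ss" "length ss = ar j" using insert.prems t by auto
  have "\<exists>S' m'. m \<le> m' \<and> (\<forall>\<sigma>. \<forall>b<m. S' \<sigma> b = S \<sigma> b) \<and>
     (\<forall>(j, ss) \<in> K. \<forall>q. (\<forall>k<ar j. \<forall>b<m'. q k b = S' (ss ! k) b) \<longrightarrow> U j q)"
    by (rule insert.IH) (use insert.prems in blast)
  then obtain S' m' where 1: "m \<le> m'" "\<forall>\<sigma>. \<forall>b<m. S' \<sigma> b = S \<sigma> b"
    and K: "\<forall>(j, ss)\<in>K. \<forall>q. (\<forall>k<ar j. \<forall>b<m'. q k b = S' (ss ! k) b) \<longrightarrow> U j q"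
    by (elim exE conjE)
  have 2: "U j q" if "(j, ss) \<in> K" "\<forall>k<ar j. \<forall>b<m'. q k b = S' (ss ! k) b" for j ss q
    using bspec[OF K that(1)] that(2) by simp
  obtain q' m'' where 3: "\<And>k b. k < ar j \<Longrightarrow> b < m' \<Longrightarrow> q' k b = S' (ss ! k) b"
    and 4: "\<And>q''. (\<forall>k<ar j. \<forall>b<m''. q'' k b = q' k b) \<Longrightarrow> U j q''"
    using dense[of j m' "\<lambda>k. S' (ss ! k)"] by blast
  \<comment> \<open>\<open>THE\<close> returns the position of \<open>\<sigma>\<close> in
    \<open>ss\<close>, unique because \<open>ss\<close> is distinct.\<close>
  define S'' where "S'' \<sigma> = (if \<sigma> \<in> set ss then q' (THE k. k < ar j \<and> ss ! k = \<sigma>) else S' \<sigma>)" for \<sigma>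
  have the: "(THE k'. k' < ar j \<and> ss ! k' = ss ! k) = k" if "k < ar j" for k
    using that ss by (intro the_equality) (auto simp: nth_eq_iff_index_eq)
  have S''_nth: "S'' (ss ! k) = q' k" if "k < ar j" for k
    using that ss the[OF that] by (simp add: S''_def)
  have S''_agree: "S'' \<sigma> b = S' \<sigma> b" if "b < m'" for \<sigma> b
  proof (cases "\<sigma> \<in> set ss")
    case True
    then obtain k where "k < ar j" "\<sigma> = ss ! k" using ss by (metis in_set_conv_nth)
    with S''_nth 3 that show ?thesis by simp
  qed (simp add: S''_def)
  show ?case
  proof (intro exI[of _ S''] exI[of _ "max m' m''"] conjI)
    show "m \<le> max m' m''" using 1 by simp
    show "\<forall>\<sigma>. \<forall>b<m. S'' \<sigma> b = S \<sigma> b" using 1 S''_agree by auto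
    have "U j' q" if "(j', ss') \<in> insert t K" and q: "\<forall>k<ar j'. \<forall>b<max m' m''. q k b = S'' (ss' ! k) b"
      for j' ss' q
    proof (cases "(j', ss') \<in> K")
      case True
      then show ?thesis using q S''_agree by (intro 2[OF True]) auto
    next
      case False
      then have "j' = j" "ss' = ss" using that t by auto
      then show ?thesis using q S''_nth 4 by auto
    qed
    then show "\<forall>(j, ss)\<in>insert t K. \<forall>q. (\<forall>k<ar j. \<forall>b<max m' m''. q k b = S'' (ss ! k) b) \<longrightarrow> U j q"
      by blast
  qed
qed

text \<open>Only finitely many first differences occur, and prefixes longer than all of them are
  distinct.\<close>

lemma prefixes_eventually_inj:
  fixes z :: "nat \<Rightarrow> nat \<Rightarrow> bool"
  assumes "inj_on z {..<a}"
  shows "\<exists>N. \<forall>t\<ge>N. inj_on (\<lambda>k. map (z k) [0..<t]) {..<a}"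
proof -
  define d where "d k l = (LEAST b. z k b \<noteq> z l b)" for k l
  define N where "N = Suc (\<Sum>k<a. \<Sum>l<a. d k l)"
  have dN: "d k l < N" if "k < a" "l < a" for k l
  proof -
    have "d k l \<le> (\<Sum>l<a. d k l)" using that by (intro member_le_sum) auto
    also have "\<dots> \<le> (\<Sum>k<a. \<Sum>l<a. d k l)"
      using that by (intro member_le_sum[where f="\<lambda>k. \<Sum>l<a. d k l"]) auto
    finally show ?thesis by (simp add: N_def)
  qed
  have "inj_on (\<lambda>k. map (z k) [0..<t]) {..<a}" if "N \<le> t" for t
  proof (rule inj_onI, rule ccontr)
    fix k l assume kl: "k \<in> {..<a}" "l \<in> {..<a}" "map (z k) [0..<t] = map (z l) [0..<t]" "k \<noteq> l"
    then have "z k \<noteq> z l" using assms by (auto dest: inj_onD)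
    then have "\<exists>b. z k b \<noteq> z l b" by auto
    then have "z k (d k l) \<noteq> z l (d k l)" unfolding d_def by (rule LeastI_ex)
    moreover have "d k l < t" using dN kl that by (meson lessThan_iff less_le_trans)
    ultimately show False using kl(3) by auto
  qed
  then show ?thesis by blast
qed

text \<open>Fusion along the binary tree: at stage \<open>t\<close> all injective tuples of nodes of length \<open>Suc t\<close> are
  pushed into the first \<open>t\<close> dense open requirements.\<close>
lemma mycielski:
  fixes ar :: "nat \<Rightarrow> nat" and U :: "nat \<Rightarrow> (nat \<Rightarrow> nat \<Rightarrow> bool) \<Rightarrow> bool"
  assumes dense: "\<And>j q m. \<exists>q' m'. (\<forall>k<ar j. \<forall>b<m. q' k b = q k b) \<and>
      (\<forall>q''. (\<forall>k<ar j. \<forall>b<m'. q'' k b = q' k b) \<longrightarrow> U j q'')"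
  shows "\<exists>(\<phi> :: (nat \<Rightarrow> bool) \<Rightarrow> nat \<Rightarrow> bool) \<psi>. (\<forall>z b. \<phi> z b = \<psi> b (map z [0..<Suc b])) \<and>
     (\<forall>j z. inj_on z {..<ar j} \<longrightarrow> U j (\<lambda>k. \<phi> (z k)))"
proof -
  \<comment> \<open>A state \<open>p\<close> holds the number \<open>fst p\<close> of decided bits
    and the bits \<open>snd p\<close> attached to the nodes. A node of length \<open>Suc t\<close>
    inherits the decided bits of its parent \<open>take t \<sigma>\<close>.\<close>
  define Q where "Q t p p' \<longleftrightarrow> fst p < fst p' \<and>
      (\<forall>\<sigma>. length \<sigma> = Suc t \<longrightarrow> (\<forall>b<fst p. snd p' \<sigma> b = snd p (take t \<sigma>) b)) \<and>
      (\<forall>j\<le>t. \<forall>ss. distinct ss \<and> length ss = ar j \<and> (\<forall>s\<in>set ss. length s = Suc t) \<longrightarrow>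
         (\<forall>q. (\<forall>k<ar j. \<forall>b<fst p'. q k b = snd p' (ss ! k) b) \<longrightarrow> U j q))"
    for t and p p' :: "nat \<times> (bool list \<Rightarrow> nat \<Rightarrow> bool)"
  have "\<exists>p'. Q t p p'" for t p
  proof -
    define K where "K = {(j, ss). j \<le> t \<and> distinct ss \<and> length ss = ar j \<and> (\<forall>s\<in>set ss. length (s :: bool list) = Suc t)}"
    have fin: "finite {ss. set ss \<subseteq> {s :: bool list. length s = Suc t} \<and> length ss = l}" for l
    proof -
      have "finite {s :: bool list. length s = Suc t}"
        using finite_lists_length_eq[of "UNIV :: bool set" "Suc t"] by simp
      then show ?thesis by (rule finite_lists_length_eq)
    qed
    have "K \<subseteq> (SIGMA j:{..t}. {ss. set ss \<subseteq> {s. length s = Suc t} \<and> length ss = ar j})"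
      by (auto simp: K_def)
    then have "finite K" by (rule finite_subset) (auto intro: fin)
    from fusion_step[where S = "\<lambda>\<sigma>. snd p (take t \<sigma>)" and m = "Suc (fst p)" and ar = ar and U = U, OF dense this]
    obtain S' m' where "Suc (fst p) \<le> m'" "\<forall>\<sigma>. \<forall>b<Suc (fst p). S' \<sigma> b = snd p (take t \<sigma>) b"
      "\<forall>(j, ss) \<in> K. \<forall>q. (\<forall>k<ar j. \<forall>b<m'. q k b = S' (ss ! k) b) \<longrightarrow> U j q"
      by (auto simp: K_def)
    then have "Q t p (m', S')" unfolding Q_def K_def by auto
    then show ?thesis by blast
  qed
  then obtain f where f: "\<And>t. Q t (f t) (f (Suc t))"
    using dependent_nat_choice[of "\<lambda>_ _. True" Q] by auto
  define m where "m t = fst (f t)" for t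
  define S where "S t = snd (f t)" for t
  have m_less: "m t < m (Suc t)" for t using f[of t] by (simp add: Q_def m_def)
  then have m_mono: "strict_mono m" by (simp add: strict_mono_Suc_iff)
  have m_ge: "t \<le> m t" for t using m_mono by (rule strict_mono_imp_increasing)
  have S_Suc: "S (Suc t) \<sigma> b = S t (take t \<sigma>) b" if "length \<sigma> = Suc t" "b < m t" for t \<sigma> b
    using f[of t] that by (simp add: Q_def m_def S_def)
  have stable: "S t' (map z [0..<t']) b = S t (map z [0..<t]) b" if "t \<le> t'" "b < m t" for t t' z b
    using that(1)
  proof (induction t' rule: dec_induct)
    case (step u)
    have "b < m u" using that(2) step.hyps(1) m_mono by (meson less_le_trans strict_mono_less_eq)
    then show ?case using step.IH S_Suc[of "map z [0..<Suc u]" u b]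
      by (simp add: take_map)
  qed simp
  \<comment> \<open>Bit \<open>b\<close> is read at stage \<open>Suc b\<close>, where it is final
    because \<open>b < m (Suc b)\<close>. It thus depends on \<open>Suc b\<close> bits of
    \<open>z\<close> alone, which later makes the labels Borel.\<close>
  define \<psi> where "\<psi> b l = S (Suc b) l b" for b l
  define \<phi> where "\<phi> z b = \<psi> b (map z [0..<Suc b])" for z b
  have \<phi>_eq: "\<phi> z b = S t (map z [0..<t]) b" if "b < m t" for z b t
  proof (cases "Suc b \<le> t")
    case True
    then show ?thesis using stable[of "Suc b" t b z] m_ge[of "Suc b"] by (simp add: \<phi>_def \<psi>_def)
  next
    case False
    then show ?thesis using stable[of t "Suc b" b z] that by (simp add: \<phi>_def \<psi>_def)
  qed
  have "U j (\<lambda>k. \<phi> (z k))" if inj: "inj_on z {..<ar j}" for j z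
  proof -
    obtain N where N: "\<And>t. N \<le> t \<Longrightarrow> inj_on (\<lambda>k. map (z k) [0..<t]) {..<ar j}"
      using prefixes_eventually_inj[OF inj] by blast
    \<comment> \<open>Late enough for the prefixes to be distinct and for requirement
      \<open>j\<close> to be served.\<close>
    define t where "t = max N j"
    define ss where "ss = map (\<lambda>k. map (z k) [0..<Suc t]) [0..<ar j]"
    have "distinct ss"
      using N[of "Suc t"] by (auto simp: ss_def distinct_map t_def atLeast0LessThan simp del: upt_Suc)
    moreover have "length ss = ar j" "\<forall>s\<in>set ss. length s = Suc t" "j \<le> t"
      by (auto simp: ss_def t_def)
    ultimately have *: "U j q" if "\<forall>k<ar j. \<forall>b<m (Suc t). q k b = S (Suc t) (ss ! k) b" for q
      using f[of t] that unfolding Q_def m_def S_def by blast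
    show ?thesis
    proof (rule *, intro allI impI)
      fix k b assume "k < ar j" "b < m (Suc t)"
      then show "\<phi> (z k) b = S (Suc t) (ss ! k) b"
        by (simp only: \<phi>_eq) (simp add: ss_def del: upt_Suc)
    qed
  qed
  then show ?thesis using \<phi>_def by blast
qed

section \<open>Finite patterns in the space \<open>Xset n\<close>\<close>

definition agree :: "enat \<Rightarrow> nat \<Rightarrow> pt \<Rightarrow> pt \<Rightarrow> bool" where
  "agree n L y y' \<longleftrightarrow> (\<forall>i<L. enat i < n \<longrightarrow> (\<forall>k<L. \<forall>m<L. y i k m = y' i k m))"

lemma agree_trans: "agree n L y y' \<Longrightarrow> agree n L y' y'' \<Longrightarrow> agree n L y y''"
  by (auto simp: agree_def)

lemma agree_mono: "agree n L y y' \<Longrightarrow> L' \<le> L \<Longrightarrow> agree n L' y y'"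
  by (auto simp: agree_def)

text \<open>A basic box constrains finitely many coordinates, so one \<open>N\<close> bounds their
  indices and radii. The abstract nearness \<open>nr\<close> allows iteration through the three
  nested products.\<close>

lemma openin_product_nbhd:
  fixes nr :: "nat \<Rightarrow> 'a \<Rightarrow> 'a \<Rightarrow> bool"
  assumes base: "\<And>V z. openin X V \<Longrightarrow> z \<in> V \<Longrightarrow> \<exists>N. \<forall>z'\<in>topspace X. nr N z z' \<longrightarrow> z' \<in> V"
    and anti: "\<And>N N' z z'. N \<le> N' \<Longrightarrow> nr N' z z' \<Longrightarrow> nr N z z'"
    and U: "openin (product_topology (\<lambda>_. X) I) U" "y \<in> U"
  shows "\<exists>N. \<forall>y'\<in>topspace (product_topology (\<lambda>_. X) I). (\<forall>i\<in>I. i < N \<longrightarrow> nr N (y i) (y' i)) \<longrightarrow> y' \<in> U"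
proof -
  obtain W where W: "finite {i \<in> I. W i \<noteq> topspace X}" "\<And>i. i \<in> I \<Longrightarrow> openin X (W i)"
    "y \<in> Pi\<^sub>E I W" "Pi\<^sub>E I W \<subseteq> U"
    using U unfolding openin_product_topology_alt by metis
  have "\<exists>N. \<forall>z'\<in>topspace X. nr N (y i) z' \<longrightarrow> z' \<in> W i" if "i \<in> I" for i
    using base[OF W(2)[OF that]] W(3) that by (auto simp: PiE_mem)
  then obtain M where M: "\<And>i z'. i \<in> I \<Longrightarrow> z' \<in> topspace X \<Longrightarrow> nr (M i) (y i) z' \<Longrightarrow> z' \<in> W i"
    by metis
  define F where "F = {i \<in> I. W i \<noteq> topspace X}"
  define N where "N = Suc (\<Sum>i\<in>F. i + M i)"
  have N: "i < N" "M i \<le> N" if "i \<in> F" for i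
    using member_le_sum[of i F "\<lambda>i. i + M i"] W(1) that by (auto simp: F_def N_def)
  have "y' \<in> U" if y': "y' \<in> topspace (product_topology (\<lambda>_. X) I)"
    and nr: "\<forall>i\<in>I. i < N \<longrightarrow> nr N (y i) (y' i)" for y'
  proof -
    have "y' \<in> Pi\<^sub>E I W"
    proof (rule PiE_I)
      fix i assume i: "i \<in> I"
      have top: "y' i \<in> topspace X" using y' i by (auto simp: PiE_mem)
      show "y' i \<in> W i"
      proof (cases "i \<in> F")
        case True
        then show ?thesis using N[OF True] nr anti i by (intro M[OF i top]) blast
      next
        case False
        then show ?thesis using top i by (auto simp: F_def)
      qed
    next
      fix i assume "i \<notin> I"
      then show "y' i = undefined" using y' by (auto simp: PiE_def extensional_def)
    qed
    then show ?thesis using W(4) by blast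
  qed
  then show ?thesis by blast
qed

lemma topspace_cantor_top [simp]: "topspace cantor_top = UNIV"
  by (simp add: cantor_top_def)

lemma topspace_seq_top [simp]: "topspace seq_top = UNIV"
  by (simp add: seq_top_def)

lemma topspace_ambient_top: "topspace (ambient_top n) = {y. \<forall>i. \<not> enat i < n \<longrightarrow> y i = undefined}"
  by (auto simp: ambient_top_def PiE_def extensional_def)

lemma topspace_Xtop [simp]: "topspace (Xtop n) = Xset n"
  by (auto simp: Xtop_def Xset_def)

lemma openin_Xtop_nbhd:
  assumes "openin (Xtop n) U" "y \<in> U"
  shows "\<exists>L. \<forall>y'\<in>Xset n. agree n L y y' \<longrightarrow> y' \<in> U"
proof -
  define n1 :: "nat \<Rightarrow> (nat \<Rightarrow> bool) \<Rightarrow> (nat \<Rightarrow> bool) \<Rightarrow> bool"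
    where "n1 N z z' \<longleftrightarrow> (\<forall>m<N. z m = z' m)" for N z z'
  define n2 :: "nat \<Rightarrow> (nat \<Rightarrow> nat \<Rightarrow> bool) \<Rightarrow> (nat \<Rightarrow> nat \<Rightarrow> bool) \<Rightarrow> bool"
    where "n2 N z z' \<longleftrightarrow> (\<forall>k<N. n1 N (z k) (z' k))" for N z z'
  have b1: "\<exists>N. \<forall>z'\<in>topspace cantor_top. n1 N z z' \<longrightarrow> z' \<in> V" if "openin cantor_top V" "z \<in> V" for V z
    using openin_product_nbhd[of "discrete_topology UNIV" "\<lambda>N. (=)" UNIV V z] that
    unfolding cantor_top_def n1_def by force
  have b2: "\<exists>N. \<forall>z'\<in>topspace seq_top. n2 N z z' \<longrightarrow> z' \<in> V" if "openin seq_top V" "z \<in> V" for V z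
    using openin_product_nbhd[of cantor_top n1 UNIV V z, OF b1] that
    unfolding seq_top_def n2_def by (force simp: n1_def)
  obtain W where W: "openin (ambient_top n) W" "U = W \<inter> Xset n"
    using assms(1) by (auto simp: Xtop_def openin_subtopology)
  have "\<exists>N. \<forall>y'\<in>topspace (ambient_top n). (\<forall>i\<in>{i. enat i < n}. i < N \<longrightarrow> n2 N (y i) (y' i)) \<longrightarrow> y' \<in> W"
    unfolding ambient_top_def
    by (rule openin_product_nbhd[OF b2])
      (use W assms(2) in \<open>auto simp: ambient_top_def n1_def n2_def\<close>)
  then obtain N where N: "\<And>y'. y' \<in> topspace (ambient_top n) \<Longrightarrow>
      (\<forall>i. enat i < n \<longrightarrow> i < N \<longrightarrow> n2 N (y i) (y' i)) \<Longrightarrow> y' \<in> W" by auto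
  have "\<forall>y'\<in>Xset n. agree n N y y' \<longrightarrow> y' \<in> U"
  proof (intro ballI impI)
    fix y' assume y': "y' \<in> Xset n" "agree n N y y'"
    have "y' \<in> W"
      by (rule N) (use y' in \<open>simp_all add: Xset_def agree_def n1_def n2_def\<close>)
    then show "y' \<in> U" using y' W(2) by simp
  qed
  then show ?thesis by blast
qed

lemma continuous_map_Xtop_bit:
  assumes "enat i < n"
  shows "continuous_map (Xtop n) (discrete_topology UNIV) (\<lambda>x. x i k m)"
proof -
  have "continuous_map (ambient_top n) seq_top (\<lambda>x. x i)"
    unfolding ambient_top_def by (rule continuous_map_product_projection) (simp add: assms)
  moreover have "continuous_map seq_top cantor_top (\<lambda>x. x k)"
    unfolding seq_top_def by (rule continuous_map_product_projection) simp
  moreover have "continuous_map cantor_top (discrete_topology UNIV) (\<lambda>x. x m)"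
    unfolding cantor_top_def by (rule continuous_map_product_projection) simp
  ultimately have "continuous_map (ambient_top n) (discrete_topology UNIV) ((\<lambda>x. x m) \<circ> (\<lambda>x. x k) \<circ> (\<lambda>x. x i))"
    by (blast intro: continuous_map_compose)
  then show ?thesis unfolding Xtop_def
    by (auto simp: comp_def intro: continuous_map_from_subtopology)
qed

lemma openin_Xtop_bit:
  assumes "enat i < n"
  shows "openin (Xtop n) {x \<in> Xset n. x i k m = b}"
  using openin_continuous_map_preimage[OF continuous_map_Xtop_bit[OF assms, of k m], of "{b}"] by simp

lemma openin_Xtop_agree: "openin (Xtop n) {y' \<in> Xset n. agree n L y y'}"
proof -
  define P where "P = {p \<in> {..<L} \<times> {..<L} \<times> {..<L}. enat (fst p) < n}"
  define A where "A = (\<lambda>(i, k, m). {y' \<in> Xset n. y' i k m = y i k m})"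
  have eq: "{y' \<in> Xset n. agree n L y y'} = Xset n \<inter> \<Inter> (A ` P)"
    by (auto simp: agree_def P_def A_def)
  have "finite P" by (simp add: P_def)
  moreover have "openin (Xtop n) (A p)" if "p \<in> P" for p
    using that by (auto simp: A_def P_def intro: openin_Xtop_bit)
  ultimately have "openin (Xtop n) (Xset n \<inter> \<Inter> (A ` P))"
    using openin_topspace[of "Xtop n"]
    by (cases "P = {}") (auto intro!: openin_Int openin_Inter)
  then show ?thesis by (simp only: eq)
qed

text \<open>Every finite pattern extends to a point of \<open>Xset n\<close>: make all rows distinct beyond the pattern,
  so that the third condition becomes vacuous.\<close>
lemma Xset_agree_ex: "\<exists>y'\<in>Xset n. agree n L y y'"
proof -
  \<comment> \<open>Outside the block the ones lie on the lines \<open>m = k + L\<close> and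
    \<open>k = m + L\<close>, which meet every row and every column. The value
    \<open>undefined\<close> is forced by the extensional product.\<close>
  define y' where "y' i k m = (if enat i < n then
      if k < L \<and> m < L then y i k m else m = k + L \<or> (k = m + L)
    else undefined k m)" for i k m
  have val: "y' i k m = (if k < L \<and> m < L then y i k m else m = k + L \<or> k = m + L)" if "enat i < n" for i k m
    using that by (simp add: y'_def)
  have und: "y' i = undefined" if "\<not> enat i < n" for i
    using that by (intro ext) (simp add: y'_def)
  have inj: "k = l" if "y' i k = y' i l" "enat i < n" for i k l
  proof -
    have diag: "y' i a (a + L)" for a by (simp add: val that(2))
    \<comment> \<open>Column \<open>a + L\<close> has ones only in rows \<open>a\<close> and
      \<open>a + L + L\<close>. Equal rows would have to satisfy this both ways, which leaves only
      \<open>k = l\<close>.\<close>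
    have *: "b = a \<or> b = a + L + L" if "y' i b (a + L)" for a b
      using that \<open>enat i < n\<close> by (auto simp: val)
    have "y' i l (k + L)" "y' i k (l + L)" using diag[of k] diag[of l] that(1) by simp_all
    then show ?thesis using *[of l k] *[of k l] by linarith
  qed
  have "y' \<in> Xset n" unfolding Xset_def
  proof (intro CollectI conjI allI impI)
    show "y' \<in> topspace (ambient_top n)" by (simp add: topspace_ambient_top und)
    fix i assume i: "1 \<le> i \<and> enat i < n"
    show "\<exists>k. y' i k m" for m by (rule exI[of _ "m + L"]) (use i in \<open>simp add: val\<close>)
    show "\<exists>m. y' i k m" for k by (rule exI[of _ "k + L"]) (use i in \<open>simp add: val\<close>)
    have "enat (i - 1) < n" using i by (meson diff_le_self enat_ord_simps(1) le_less_trans)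
    then show "y' i k l1 = y' i k l2" if "y' (i - 1) l1 = y' (i - 1) l2" for k l1 l2
      using inj[of "i - 1" l1 l2] that by simp
  qed
  moreover have "agree n L y y'" by (auto simp: agree_def val)
  ultimately show ?thesis by blast
qed

section \<open>Comeager sets in terms of finite patterns\<close>

definition forced :: "enat \<Rightarrow> pt set \<Rightarrow> nat \<Rightarrow> pt \<Rightarrow> bool" where
  "forced n D L y \<longleftrightarrow> (\<forall>y'\<in>Xset n. agree n L y y' \<longrightarrow> y' \<in> D)"

lemma forced_cong: "agree n L y y' \<Longrightarrow> forced n D L y \<Longrightarrow> forced n D L y'"
  by (auto simp: forced_def intro: agree_trans)

text \<open>\<open>D t\<close> is the complement of the closure of the \<open>t\<close>-th nowhere
  dense set. As every finite pattern is realised in \<open>Xset n\<close>, density of this open set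
  means that every pattern extends to one forcing membership in \<open>D t\<close>.\<close>

lemma comeager_forced:
  assumes "comeager_in (Xtop n) C"
  shows "\<exists>D :: nat \<Rightarrow> pt set. (\<forall>t L y. \<exists>L'\<ge>L. \<exists>y'. agree n L y y' \<and> forced n (D t) L' y') \<and>
     (\<forall>y\<in>Xset n. (\<forall>t. \<exists>L. forced n (D t) L y) \<longrightarrow> y \<in> C)"
proof -
  obtain N where N: "\<And>k::nat. nowhere_dense_in (Xtop n) (N k)" "Xset n - C \<subseteq> (\<Union>k. N k)"
    using assms by (auto simp: comeager_in_def meager_in_def)
  define D where "D t = Xset n - (Xtop n) closure_of (N t)" for t
  have D_open: "openin (Xtop n) (D t)" for t
    using openin_diff[OF openin_topspace closedin_closure_of, of "Xtop n" "N t"] by (simp add: D_def)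
  have "\<exists>L'\<ge>L. \<exists>y'. agree n L y y' \<and> forced n (D t) L' y'" for t L y
  proof -
    let ?V = "{y' \<in> Xset n. agree n L y y'}"
    have "\<not> ?V \<subseteq> (Xtop n) closure_of (N t)"
    proof
      assume "?V \<subseteq> (Xtop n) closure_of (N t)"
      then have "?V \<subseteq> (Xtop n) interior_of ((Xtop n) closure_of (N t))"
        using openin_Xtop_agree by (rule interior_of_maximal)
      then show False using N(1)[of t] Xset_agree_ex[of n L y] by (auto simp: nowhere_dense_in_def)
    qed
    then obtain y' where y': "y' \<in> Xset n" "agree n L y y'" "y' \<in> D t" by (auto simp: D_def)
    obtain M where M: "\<And>y''. y'' \<in> Xset n \<Longrightarrow> agree n M y' y'' \<Longrightarrow> y'' \<in> D t"
      using openin_Xtop_nbhd[OF D_open y'(3)] by blast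
    have "forced n (D t) (max L M) y'"
      unfolding forced_def using M by (meson agree_mono max.cobounded2)
    then show ?thesis using y'(2) by (meson max.cobounded1)
  qed
  moreover have "y \<in> C" if "y \<in> Xset n" "\<forall>t. \<exists>L. forced n (D t) L y" for y
  proof (rule ccontr)
    assume "y \<notin> C"
    then have "y \<in> (\<Union>k. N k)" using N(2) that(1) by blast
    then obtain t where t: "y \<in> N t" by blast
    moreover have "y \<in> D t" using that by (auto simp: forced_def agree_def)
    ultimately show False using closure_of_subset[of "N t" "Xtop n"] N(1)[of t]
      by (auto simp: D_def nowhere_dense_in_def)
  qed
  ultimately show ?thesis by blast
qed

section \<open>Elements and their relations\<close>

type_synonym pattern = "(bool \<times> bool) list list"
type_synonym elem = "hs list \<times> nat"

fun hmem :: "hs \<Rightarrow> hs \<Rightarrow> bool" where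
  "hmem h (Atom z) = False"
| "hmem h (HSet S) = (h \<in> rcset S)"

definition pat :: "hs list \<Rightarrow> hs list \<Rightarrow> pattern" where
  "pat F G = map (\<lambda>f. map (\<lambda>g. (f = g, hmem f g)) G) F"

text \<open>The two lists prescribe relations to elements above and below, the bit list is an
  initial segment of the label, and the last number is padding that gives the same data arbitrarily
  large codes.\<close>

definition code_data :: "nat \<Rightarrow> (nat \<times> pattern) list \<times> (nat \<times> pattern) list \<times> bool list \<times> nat" where
  "code_data = from_nat"

definition upper_spec :: "nat \<Rightarrow> (nat \<times> pattern) set" where
  "upper_spec c = set (fst (code_data c))"

definition lower_spec :: "nat \<Rightarrow> (nat \<times> pattern) set" where
  "lower_spec c = set (fst (snd (code_data c)))"

definition stem :: "nat \<Rightarrow> bool list" where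
  "stem c = fst (snd (snd (code_data c)))"

text \<open>Letting the larger code decide allows a new element to prescribe its relations to all elements
  chosen before it.\<close>
definition rel_code :: "nat \<Rightarrow> nat \<Rightarrow> pattern \<Rightarrow> bool" where
  "rel_code c d p \<longleftrightarrow> (if d < c then (d, p) \<in> upper_spec c else (c, p) \<in> lower_spec d)"

definition rel :: "elem \<Rightarrow> elem \<Rightarrow> bool" where
  "rel u v = rel_code (snd u) (snd v) (pat (fst u) (fst v))"

lemma code_ex:
  "\<exists>c>N. upper_spec c = set P \<and> lower_spec c = set Q \<and> stem c = w"
proof -
  have inj: "inj (\<lambda>j::nat. to_nat (P, Q, w, j))" by (auto intro!: injI)
  then have "infinite (range (\<lambda>j::nat. to_nat (P, Q, w, j)))" by (rule range_inj_infinite)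
  then obtain c where "c \<in> range (\<lambda>j::nat. to_nat (P, Q, w, j))" "N < c"
    using infinite_nat_iff_unbounded by blast
  then show ?thesis by (auto simp: upper_spec_def lower_spec_def stem_def code_data_def)
qed

lemma pat_eq_iff:
  "pat F G = pat F G' \<longleftrightarrow> (\<forall>f\<in>set F. map (\<lambda>g. (f = g, hmem f g)) G = map (\<lambda>g. (f = g, hmem f g)) G')"
  by (simp add: pat_def)

section \<open>Separating lists of sets by their patterns\<close>

definition admissible :: "hs set \<Rightarrow> hs \<Rightarrow> bool" where
  "admissible S f \<longleftrightarrow> f \<in> S \<or> (\<exists>T. f = HSet T \<and> rcset T \<subseteq> S)"

text \<open>If \<open>f\<close> or \<open>g\<close> lies in \<open>S\<close>, its own equality entry
  separates them. Otherwise both are sets of elements of \<open>S\<close>, and extensionality gives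
  a member of just one.\<close>

lemma admissible_separated:
  assumes "admissible S f" "admissible S g" "f \<noteq> g"
  shows "\<exists>e\<in>S. (e = f, hmem e f) \<noteq> (e = g, hmem e g)"
proof (cases "f \<in> S \<or> g \<in> S")
  case True
  then show ?thesis using assms(3) by auto
next
  case False
  then obtain T T' where T: "f = HSet T" "g = HSet T'" "rcset T \<subseteq> S" "rcset T' \<subseteq> S"
    using assms by (auto simp: admissible_def)
  then have "rcset T \<noteq> rcset T'" using assms(3) by (auto simp: rcset_inject)
  then obtain e where "e \<in> rcset T \<longleftrightarrow> e \<notin> rcset T'" by blast
  then show ?thesis using T by (intro bexI[of _ e]) auto
qed

lemma pat_separates_pair:
  assumes "G \<noteq> G'" "\<And>g. g \<in> set G \<union> set G' \<Longrightarrow> admissible S g" "S \<noteq> {}"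
  shows "\<exists>e\<in>S. map (\<lambda>g. (e = g, hmem e g)) G \<noteq> map (\<lambda>g. (e = g, hmem e g)) G'"
proof (cases "length G = length G'")
  case True
  then obtain j where j: "j < length G" "G ! j \<noteq> G' ! j" using assms(1) nth_equalityI by blast
  then obtain e where e: "e \<in> S" "(e = G ! j, hmem e (G ! j)) \<noteq> (e = G' ! j, hmem e (G' ! j))"
    using admissible_separated[of S "G ! j" "G' ! j"] assms(2) True by auto
  then have "map (\<lambda>g. (e = g, hmem e g)) G ! j \<noteq> map (\<lambda>g. (e = g, hmem e g)) G' ! j"
    using j True by simp
  then show ?thesis using e(1) by metis
next
  case False
  then show ?thesis using assms(3) by (metis ex_in_conv length_map)
qed

text \<open>One separator is chosen for each of the finitely many pairs. A new element whose list
  contains these separators can address the lists in \<open>\<G>\<close> by their patterns.\<close>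

lemma pat_separates_above:
  assumes "finite \<G>" "\<And>G g. G \<in> \<G> \<Longrightarrow> g \<in> set G \<Longrightarrow> admissible S g" "S \<noteq> {}"
  shows "\<exists>E\<subseteq>S. finite E \<and> (\<forall>F. E \<subseteq> set F \<longrightarrow> inj_on (pat F) \<G>)"
proof -
  define e where "e = (\<lambda>(G, G'). SOME e. e \<in> S \<and> map (\<lambda>g. (e = g, hmem e g)) G \<noteq> map (\<lambda>g. (e = g, hmem e g)) G')"
  have e: "e (G, G') \<in> S \<and> map (\<lambda>g. (e (G, G') = g, hmem (e (G, G')) g)) G \<noteq> map (\<lambda>g. (e (G, G') = g, hmem (e (G, G')) g)) G'"
    if "G \<in> \<G>" "G' \<in> \<G>" "G \<noteq> G'" for G G'
  proof -
    have "\<exists>e. e \<in> S \<and> map (\<lambda>g. (e = g, hmem e g)) G \<noteq> map (\<lambda>g. (e = g, hmem e g)) G'"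
      using pat_separates_pair[OF that(3) _ assms(3)] assms(2) that by blast
    then show ?thesis unfolding e_def prod.case by (rule someI_ex)
  qed
  define E where "E = e ` {(G, G'). G \<in> \<G> \<and> G' \<in> \<G> \<and> G \<noteq> G'}"
  have "{(G, G'). G \<in> \<G> \<and> G' \<in> \<G> \<and> G \<noteq> G'} \<subseteq> \<G> \<times> \<G>" by auto
  then have "finite {(G, G'). G \<in> \<G> \<and> G' \<in> \<G> \<and> G \<noteq> G'}" using assms(1) finite_subset by blast
  then have "finite E" by (simp add: E_def)
  moreover have "E \<subseteq> S" using e by (auto simp: E_def)
  moreover have "inj_on (pat F) \<G>" if F: "E \<subseteq> set F" for F
  proof (rule inj_onI, rule ccontr)
    fix G G' assume G: "G \<in> \<G>" "G' \<in> \<G>" "pat F G = pat F G'" "G \<noteq> G'"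
    then have "e (G, G') \<in> set F" using F by (auto simp: E_def)
    then show False using e[OF G(1,2,4)] G(3) unfolding pat_eq_iff by blast
  qed
  ultimately show ?thesis by blast
qed

text \<open>Each entry of \<open>G\<close> occurs somewhere in \<open>F\<close>, and the equality
  entry at that place identifies it.\<close>

lemma pat_separates_below:
  assumes "set G \<subseteq> set F" "pat G F = pat G' F"
  shows "G = G'"
proof (rule nth_equalityI)
  show len: "length G = length G'" using arg_cong[OF assms(2), of length] by (simp add: pat_def)
  fix j assume j: "j < length G"
  then obtain r where r: "r < length F" "F ! r = G ! j" using assms(1) by (metis in_set_conv_nth nth_mem subsetD)
  have "pat G F ! j ! r = pat G' F ! j ! r" using assms(2) by simp
  then show "G ! j = G' ! j" using j r len by (simp add: pat_def)
qed

text \<open>Abstracts the cumulative levels of sets coded by a point, so that the construction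
  refers to sets and not to their enumeration.\<close>

definition tower :: "(nat \<Rightarrow> hs set) \<Rightarrow> bool" where
  "tower B \<longleftrightarrow> B 0 \<noteq> {} \<and> B 0 \<subseteq> range Atom \<and>
     (\<forall>i. countable (B i) \<and> B i \<subseteq> B (Suc i) \<and> (\<forall>f\<in>B (Suc i). admissible (B i) f))"

lemma tower_subset: "tower B \<Longrightarrow> B i \<subseteq> B (Suc i)"
  by (simp add: tower_def)

lemma tower_admissible: "tower B \<Longrightarrow> f \<in> B (Suc i) \<Longrightarrow> admissible (B i) f"
  by (simp add: tower_def)

definition elems :: "(nat \<Rightarrow> hs set) \<Rightarrow> nat \<Rightarrow> elem set" where
  "elems B i = {v. set (fst v) \<subseteq> B i}"

lemma tower_nonempty: "tower B \<Longrightarrow> B i \<noteq> {}"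
proof (induction i)
  case (Suc i)
  then show ?case using tower_subset[of B i] by auto
qed (simp add: tower_def)

text \<open>The list of the new element contains enough witnesses to give the finitely many old elements
  different patterns, so its code can prescribe each relation independently.\<close>
lemma elem_extension:
  assumes B: "tower B"
    and fin: "finite \<A>" "finite \<L>"
    and above: "\<A> \<subseteq> elems B (Suc i)"
    and below: "\<L> \<noteq> {} \<Longrightarrow> \<exists>j. i = Suc j \<and> \<L> \<subseteq> elems B j"
  shows "\<exists>v\<in>elems B i. N < snd v \<and> stem (snd v) = w \<and>
    (\<forall>a\<in>\<A>. rel v a \<longleftrightarrow> \<alpha> a) \<and> (\<forall>b\<in>\<L>. rel b v \<longleftrightarrow> \<beta> b)"
proof -
  have "\<exists>E\<subseteq>B i. finite E \<and> (\<forall>F. E \<subseteq> set F \<longrightarrow> inj_on (pat F) (fst ` \<A>))"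
  proof (rule pat_separates_above)
    show "admissible (B i) g" if "G \<in> fst ` \<A>" "g \<in> set G" for G g
      using that above by (intro tower_admissible[OF B]) (auto simp: elems_def)
  qed (use fin tower_nonempty[OF B] in auto)
  then obtain E where E: "E \<subseteq> B i" "finite E" "\<And>F. E \<subseteq> set F \<Longrightarrow> inj_on (pat F) (fst ` \<A>)" by blast
  \<comment> \<open>\<open>E\<close> separates the elements above by pattern; the entries of the
    lists below are added so that \<open>pat_separates_below\<close> applies to the elements
    below.\<close>
  define E' where "E' = E \<union> (\<Union>b\<in>\<L>. set (fst b))"
  have "finite E'" using E fin by (simp add: E'_def)
  then obtain F where F: "set F = E'" using finite_list by blast
  have "set F \<subseteq> B i"
    using E(1) below tower_subset[OF B] unfolding F E'_def by (fastforce simp: elems_def)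
  have injA: "inj_on (pat F) (fst ` \<A>)" using E(3) F E'_def by blast
  obtain P where P: "set P = (\<lambda>a. (snd a, pat F (fst a))) ` {a \<in> \<A>. \<alpha> a}"
    using finite_list[of "(\<lambda>a. (snd a, pat F (fst a))) ` {a \<in> \<A>. \<alpha> a}"] fin(1) by auto
  obtain Q where Q: "set Q = (\<lambda>b. (snd b, pat (fst b) F)) ` {b \<in> \<L>. \<beta> b}"
    using finite_list[of "(\<lambda>b. (snd b, pat (fst b) F)) ` {b \<in> \<L>. \<beta> b}"] fin(2) by auto
  \<comment> \<open>A code beyond all the old ones makes \<open>rel_code\<close> consult
    \<open>c\<close> in both directions.\<close>
  obtain c where c: "c > N + (\<Sum>a\<in>\<A>. snd a) + (\<Sum>b\<in>\<L>. snd b)"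
    "upper_spec c = set P" "lower_spec c = set Q" "stem c = w"
    using code_ex by blast
  have ca: "snd a < c" if "a \<in> \<A>" for a using member_le_sum[of a \<A> snd] that fin c(1) by simp
  have cb: "snd b < c" if "b \<in> \<L>" for b using member_le_sum[of b \<L> snd] that fin c(1) by simp
  show ?thesis
  proof (intro bexI[of _ "(F, c)"] conjI ballI)
    show "(F, c) \<in> elems B i" using \<open>set F \<subseteq> B i\<close> by (simp add: elems_def)
    show "N < snd (F, c)" using c(1) by simp
    show "stem (snd (F, c)) = w" using c by simp
    fix a assume a: "a \<in> \<A>"
    have "\<alpha> a" if "(snd a, pat F (fst a)) \<in> set P"
    proof -
      obtain a' where a': "a' \<in> \<A>" "\<alpha> a'" "snd a = snd a'" "pat F (fst a) = pat F (fst a')"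
        using \<open>(snd a, pat F (fst a)) \<in> set P\<close> unfolding P by auto
      have "fst a = fst a'" using injA a a' by (auto dest: inj_onD)
      then show ?thesis using a' by (metis prod_eqI)
    qed
    moreover have "(snd a, pat F (fst a)) \<in> set P" if "\<alpha> a" using a that unfolding P by auto
    ultimately show "rel (F, c) a \<longleftrightarrow> \<alpha> a"
      using ca[OF a] c by (auto simp: rel_def rel_code_def)
  next
    fix b assume b: "b \<in> \<L>"
    have "\<beta> b" if "(snd b, pat (fst b) F) \<in> set Q"
    proof -
      obtain b' where b': "b' \<in> \<L>" "\<beta> b'" "snd b = snd b'" "pat (fst b) F = pat (fst b') F"
        using \<open>(snd b, pat (fst b) F) \<in> set Q\<close> unfolding Q by auto
      have "fst b = fst b'" by (rule pat_separates_below[OF _ b'(4)]) (use b F E'_def in auto)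
      then show ?thesis using b' by (metis prod_eqI)
    qed
    moreover have "(snd b, pat (fst b) F) \<in> set Q" if "\<beta> b" using b that unfolding Q by auto
    ultimately show "rel b (F, c) \<longleftrightarrow> \<beta> b"
      using cb[OF b] c by (auto simp: rel_def rel_code_def)
  qed
qed

text \<open>A lower element whose code is large enough detects both the code and the pattern of an element
  above it.\<close>
lemma rel_below_inj:
  assumes "S \<noteq> {}" "\<And>f. f \<in> set (fst v) \<union> set (fst v') \<Longrightarrow> admissible S f"
    and eq: "\<And>u. set (fst u) \<subseteq> S \<Longrightarrow> rel u v \<longleftrightarrow> rel u v'"
  shows "v = v'"
proof (rule ccontr)
  assume "v \<noteq> v'"
  have "\<exists>F. set F \<subseteq> S \<and> (snd v, pat F (fst v)) \<noteq> (snd v', pat F (fst v'))"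
  proof (cases "snd v = snd v'")
    case True
    then have "fst v \<noteq> fst v'" using \<open>v \<noteq> v'\<close> by (auto simp: prod_eq_iff)
    from pat_separates_pair[OF this assms(2,1)]
    obtain e where "e \<in> S" "map (\<lambda>g. (e = g, hmem e g)) (fst v) \<noteq> map (\<lambda>g. (e = g, hmem e g)) (fst v')" by blast
    then show ?thesis by (intro exI[of _ "[e]"]) (simp add: pat_def)
  next
    case False
    then show ?thesis by (intro exI[of _ "[]"]) simp
  qed
  then obtain F where F: "set F \<subseteq> S" "(snd v, pat F (fst v)) \<noteq> (snd v', pat F (fst v'))" by blast
  \<comment> \<open>As \<open>c\<close> exceeds both codes, \<open>rel\<close> consults its single
    entry, which matches \<open>v\<close> but not \<open>v'\<close>.\<close>
  obtain c where c: "c > snd v + snd v'" "upper_spec c = set [(snd v, pat F (fst v))]"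
    using code_ex by blast
  have "rel (F, c) v" "\<not> rel (F, c) v'" using c F(2) by (auto simp: rel_def rel_code_def)
  then show False using eq[of "(F, c)"] F(1) by simp
qed

section \<open>Generic labelled structures\<close>

definition overwrite :: "bool list \<Rightarrow> (nat \<Rightarrow> bool) \<Rightarrow> nat \<Rightarrow> bool" where
  "overwrite w z m = (if m < length w then w ! m else z m)"

definition atom_bit :: "hs \<Rightarrow> nat \<Rightarrow> bool" where
  "atom_bit h j = (case h of Atom z \<Rightarrow> z j | HSet S \<Rightarrow> False)"

text \<open>A real describing an element of level 0: positions tagged \<open>True\<close> record the
  length and the code, those tagged \<open>False\<close> the bits of the atoms.\<close>

definition elem_code :: "elem \<Rightarrow> nat \<Rightarrow> bool" where
  "elem_code v b = (case from_nat b :: bool \<times> nat \<times> nat of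
      (True, i, j) \<Rightarrow> i = length (fst v) \<and> j = snd v
    | (False, i, j) \<Rightarrow> i < length (fst v) \<and> atom_bit (fst v ! i) j)"

lemma elem_code_inj: "inj_on elem_code {v. set (fst v) \<subseteq> range Atom}"
proof (rule inj_onI)
  fix v v' :: elem
  assume v: "v \<in> {v. set (fst v) \<subseteq> range Atom}" "v' \<in> {v. set (fst v) \<subseteq> range Atom}"
    and eq: "elem_code v = elem_code v'"
  have bit: "elem_code v (to_nat x) = elem_code v' (to_nat x)" for x :: "bool \<times> nat \<times> nat"
    using eq by simp
  \<comment> \<open>Under the tag \<open>True\<close> exactly one bit is set, at the length and the
    code.\<close>
  have len: "length (fst v) = length (fst v')" "snd v = snd v'"
    using bit[of "(True, length (fst v), snd v)"] by (auto simp: elem_code_def)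
  have "fst v = fst v'"
  proof (rule nth_equalityI)
    show "length (fst v) = length (fst v')" by (rule len)
    fix i assume i: "i < length (fst v)"
    then have "fst v ! i \<in> range Atom" "fst v' ! i \<in> range Atom"
      using v len by (auto dest!: nth_mem simp: subset_iff)
    then obtain z z' where z: "fst v ! i = Atom z" "fst v' ! i = Atom z'" by auto
    have "z j = z' j" for j
      using bit[of "(False, i, j)"] i len z by (simp add: elem_code_def atom_bit_def)
    then show "fst v ! i = fst v' ! i" using z by auto
  qed
  then show "v = v'" using len by (simp add: prod_eq_iff)
qed

lemma countable_elems:
  assumes "tower B" shows "countable (elems B i)"
proof -
  have "elems B i = lists (B i) \<times> UNIV" by (auto simp: elems_def)
  moreover have "countable (lists (B i))" using assms by (simp add: tower_def)
  ultimately show ?thesis by simp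
qed

text \<open>\<open>\<phi>\<close> parametrises a set of mutually generic reals. By
  \<open>\<phi>_diff\<close> its values stay different after finite prefixes are overwritten. By
  \<open>forcing\<close>, finitely many distinct parameters, with any prefixes and any finite
  pattern \<open>g\<close> on the higher levels, yield a pattern that forces
  \<open>D t\<close>.\<close>

locale generic_labels =
  fixes n :: enat and D :: "nat \<Rightarrow> pt set"
    and \<phi> :: "(nat \<Rightarrow> bool) \<Rightarrow> nat \<Rightarrow> bool" and \<psi> :: "nat \<Rightarrow> bool list \<Rightarrow> bool"
  assumes \<phi>_eq: "\<phi> z b = \<psi> b (map z [0..<Suc b])"
    and \<phi>_diff: "z \<noteq> z' \<Longrightarrow> \<exists>b\<ge>N. \<phi> z b \<noteq> \<phi> z' b"
    and forcing: "inj_on s {..<L} \<Longrightarrow> \<exists>L'\<ge>L. \<exists>y'.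
        (\<forall>k<L. \<forall>m<L'. y' 0 k m = overwrite (w k) (\<phi> (s k)) m) \<and>
        (\<forall>i<L. \<forall>k<L. \<forall>m<L. 0 < i \<longrightarrow> y' i k m = g i k m) \<and> forced n (D t) L' y'"
begin

definition lab :: "elem \<Rightarrow> nat \<Rightarrow> bool" where
  "lab v = overwrite (stem (snd v)) (\<phi> (elem_code v))"

text \<open>Stems change finitely many bits, whereas values of \<open>\<phi>\<close> differ beyond
  every bound.\<close>

lemma lab_inj: "inj_on lab {v. set (fst v) \<subseteq> range Atom}"
proof (rule inj_onI, rule ccontr)
  fix v v' assume v: "v \<in> {v. set (fst v) \<subseteq> range Atom}" "v' \<in> {v. set (fst v) \<subseteq> range Atom}"
    and eq: "lab v = lab v'" and "v \<noteq> v'"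
  then have "elem_code v \<noteq> elem_code v'" using elem_code_inj by (auto dest: inj_onD)
  from \<phi>_diff[OF this, of "length (stem (snd v)) + length (stem (snd v'))"]
  obtain b where "b \<ge> length (stem (snd v)) + length (stem (snd v'))" "\<phi> (elem_code v) b \<noteq> \<phi> (elem_code v') b"
    by blast
  then have "lab v b \<noteq> lab v' b" by (simp add: lab_def overwrite_def)
  then show False using eq by simp
qed

text \<open>The hereditary set that an element will code in the new point, defined without reference
  to an enumeration.\<close>

fun beta :: "(nat \<Rightarrow> hs set) \<Rightarrow> nat \<Rightarrow> elem \<Rightarrow> hs" where
  "beta B 0 v = Atom (lab v)"
| "beta B (Suc i) v = HSet (acset (beta B i ` {w \<in> elems B i. rel w v}))"

lemma beta_cong: "(\<And>j. j < i \<Longrightarrow> B j = B' j) \<Longrightarrow> beta B i = beta B' i"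
proof (induction i)
  case (Suc i)
  then have "beta B i = beta B' i" "elems B i = elems B' i" by (auto simp: elems_def)
  then show ?case by (intro ext) simp
qed (auto intro!: ext)

text \<open>The domain is all lists of atoms, so that two towers can be compared inside it.\<close>

lemma beta_0_inj: "inj_on (beta B 0) {v. set (fst v) \<subseteq> range Atom}"
  using lab_inj by (auto simp: inj_on_def)

text \<open>Injectivity one level down recovers the elements related to \<open>v\<close>, and these
  determine \<open>v\<close> by \<open>rel_below_inj\<close>. The domain mentions \<open>B i\<close>
  only, so it also serves another tower with the same level \<open>i\<close>.\<close>

lemma beta_Suc_inj:
  assumes B: "tower B" and inj: "inj_on (beta B i) (elems B i)"
  shows "inj_on (beta B (Suc i)) {v. \<forall>f\<in>set (fst v). admissible (B i) f}"
proof (rule inj_onI)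
  fix v v' assume v: "v \<in> {v. \<forall>f\<in>set (fst v). admissible (B i) f}"
    "v' \<in> {v. \<forall>f\<in>set (fst v). admissible (B i) f}"
    and eq: "beta B (Suc i) v = beta B (Suc i) v'"
  have "countable (beta B i ` {w \<in> elems B i. rel w v})" for v
    using countable_elems[OF B, of i] by (auto intro: countable_subset)
  then have img: "beta B i ` {w \<in> elems B i. rel w v} = beta B i ` {w \<in> elems B i. rel w v'}"
    using eq by (simp add: acset_inject)
  have "{w \<in> elems B i. rel w v} = {w \<in> elems B i. rel w v'}"
    using inj_on_image_eq_iff[OF inj] img by (metis (no_types, lifting) mem_Collect_eq subsetI)
  then have "rel u v \<longleftrightarrow> rel u v'" if "set (fst u) \<subseteq> B i" for u
    using that unfolding elems_def by blast
  then show "v = v'" using v tower_nonempty[OF B] by (intro rel_below_inj[of "B i"]) auto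
qed

lemma beta_inj: "tower B \<Longrightarrow> inj_on (beta B i) (elems B i)"
proof (induction i)
  case 0
  then show ?case by (intro inj_on_subset[OF beta_0_inj]) (auto simp: tower_def elems_def)
next
  case (Suc i)
  show ?case
    by (rule inj_on_subset[OF beta_Suc_inj[OF Suc.prems Suc.IH[OF Suc.prems]]])
      (use tower_admissible[OF Suc.prems] in \<open>auto simp: elems_def\<close>)
qed

lemma elems_eq_iff: "elems B i = elems B' i \<longleftrightarrow> B i = B' i"
proof
  assume eq: "elems B i = elems B' i"
  have "f \<in> B i \<longleftrightarrow> f \<in> B' i" for f
  proof -
    have "([f], 0) \<in> elems B i \<longleftrightarrow> ([f], 0) \<in> elems B' i" using eq by simp
    then show ?thesis by (simp add: elems_def)
  qed
  then show "B i = B' i" by blast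
qed (simp add: elems_def)

text \<open>Agreement below \<open>i\<close> makes both functions \<open>beta\<close> equal at
  \<open>i\<close>. Both sets of elements lie in one domain of injectivity, so equal images come
  from equal sets.\<close>

lemma beta_images_determine:
  assumes B: "tower B" "tower B'"
    and eq: "\<And>i. enat i < N \<Longrightarrow> beta B i ` elems B i = beta B' i ` elems B' i"
  shows "enat i < N \<Longrightarrow> B i = B' i"
proof (induction i rule: less_induct)
  case (less i)
  have lower: "B j = B' j" if "j < i" for j
    using less that by (meson enat_ord_simps(2) less_trans)
  then have "beta B' i = beta B i" using beta_cong[of i B' B] by simp
  then have img: "beta B i ` elems B i = beta B i ` elems B' i" using eq[OF less.prems] by simp
  obtain X where X: "inj_on (beta B i) X" "elems B i \<subseteq> X" "elems B' i \<subseteq> X"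
  proof (cases i)
    case 0
    have "elems B i \<subseteq> {v. set (fst v) \<subseteq> range Atom}" "elems B' i \<subseteq> {v. set (fst v) \<subseteq> range Atom}"
      using B 0 by (auto simp: tower_def elems_def)
    then show ?thesis using that[of "{v. set (fst v) \<subseteq> range Atom}"] beta_0_inj 0 by blast
  next
    case (Suc j)
    have "B' j = B j" using lower Suc by simp
    then have "elems B i \<subseteq> {v. \<forall>f\<in>set (fst v). admissible (B j) f}"
      "elems B' i \<subseteq> {v. \<forall>f\<in>set (fst v). admissible (B j) f}"
      using tower_admissible[OF B(1), of _ j] tower_admissible[OF B(2), of _ j] Suc by (auto simp: elems_def)
    then show ?thesis using that beta_Suc_inj[OF B(1) beta_inj[OF B(1)]] Suc by blast
  qed
  then have "elems B i = elems B' i" using img inj_on_image_eq_iff by blast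
  then show ?case by (simp add: elems_eq_iff)
qed

section \<open>Finite partial enumerations realising a pattern\<close>

definition good :: "(nat \<Rightarrow> hs set) \<Rightarrow> (nat \<times> nat) set \<Rightarrow> (nat \<times> nat \<Rightarrow> elem) \<Rightarrow> pt \<Rightarrow> nat \<Rightarrow> bool" where
  "good B P v y N \<longleftrightarrow>
     (\<forall>i k. (i, k) \<in> P \<longrightarrow> v (i, k) \<in> elems B i) \<and>
     (\<forall>i k k'. (i, k) \<in> P \<and> (i, k') \<in> P \<and> v (i, k) = v (i, k') \<longrightarrow> k = k') \<and>
     (\<forall>i k l. (i, k) \<in> P \<and> (Suc i, l) \<in> P \<longrightarrow> y (Suc i) l k = rel (v (i, k)) (v (Suc i, l))) \<and>
     (\<forall>k m. (0, k) \<in> P \<and> m < N \<longrightarrow> y 0 k m = lab (v (0, k)) m)"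

text \<open>\<open>elem_extension\<close> supplies an element with the relations that
  \<open>y\<close> prescribes to the filled positions one level above and below, and with
  \<open>N\<close> bits of \<open>y\<close> as its stem. Its large code makes it new.\<close>

lemma good_insert:
  assumes B: "tower B" and "finite P" and good: "good B P v y N" and new: "(i, k) \<notin> P"
  shows "\<exists>w. good B (insert (i, k) P) (v((i, k) := w)) y N"
proof -
  have g1: "\<And>i k. (i, k) \<in> P \<Longrightarrow> v (i, k) \<in> elems B i"
    and g2: "\<And>i k k'. (i, k) \<in> P \<Longrightarrow> (i, k') \<in> P \<Longrightarrow> v (i, k) = v (i, k') \<Longrightarrow> k = k'"
    and g3: "\<And>i k l. (i, k) \<in> P \<Longrightarrow> (Suc i, l) \<in> P \<Longrightarrow> y (Suc i) l k = rel (v (i, k)) (v (Suc i, l))"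
    and g4: "\<And>k m. (0, k) \<in> P \<Longrightarrow> m < N \<Longrightarrow> y 0 k m = lab (v (0, k)) m"
    using good unfolding good_def by blast+
  define \<A> where "\<A> = {v (Suc i, l) | l. (Suc i, l) \<in> P}"
  define \<L> where "\<L> = {v (j, l) | j l. i = Suc j \<and> (j, l) \<in> P}"
  have "\<A> \<subseteq> v ` P" "\<L> \<subseteq> v ` P" by (auto simp: \<A>_def \<L>_def)
  then have fin: "finite \<A>" "finite \<L>" using \<open>finite P\<close> by (auto intro: finite_subset)
  \<comment> \<open>The relations are prescribed through positions; \<open>v\<close> is injective on
    each level, so each old element has only one.\<close>
  have "\<exists>w\<in>elems B i. (\<Sum>p\<in>P. snd (v p)) < snd w \<and> stem (snd w) = map (y 0 k) [0..<N] \<and>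
    (\<forall>a\<in>\<A>. rel w a \<longleftrightarrow> (\<exists>l. (Suc i, l) \<in> P \<and> v (Suc i, l) = a \<and> y (Suc i) l k)) \<and>
    (\<forall>b\<in>\<L>. rel b w \<longleftrightarrow> (\<exists>j l. i = Suc j \<and> (j, l) \<in> P \<and> v (j, l) = b \<and> y i k l))"
    using g1 by (intro elem_extension[OF B fin]) (auto simp: \<A>_def \<L>_def)
  then obtain w where w: "w \<in> elems B i" "(\<Sum>p\<in>P. snd (v p)) < snd w" "stem (snd w) = map (y 0 k) [0..<N]"
    and wA: "\<And>a. a \<in> \<A> \<Longrightarrow> rel w a \<longleftrightarrow> (\<exists>l. (Suc i, l) \<in> P \<and> v (Suc i, l) = a \<and> y (Suc i) l k)"
    and wL: "\<And>b. b \<in> \<L> \<Longrightarrow> rel b w \<longleftrightarrow> (\<exists>j l. i = Suc j \<and> (j, l) \<in> P \<and> v (j, l) = b \<and> y i k l)"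
    by blast
  have up: "y (Suc i) l k = rel w (v (Suc i, l))" if "(Suc i, l) \<in> P" for l
  proof -
    have "v (Suc i, l) \<in> \<A>" using that by (auto simp: \<A>_def)
    moreover have "l' = l" if "(Suc i, l') \<in> P" "v (Suc i, l') = v (Suc i, l)" for l'
      using g2 that \<open>(Suc i, l) \<in> P\<close> by blast
    ultimately show ?thesis using wA that by metis
  qed
  have down: "y i k l = rel (v (j, l)) w" if "(j, l) \<in> P" "i = Suc j" for j l
  proof -
    have "v (j, l) \<in> \<L>" using that by (auto simp: \<L>_def)
    moreover have "l' = l" if "(j, l') \<in> P" "v (j, l') = v (j, l)" for l'
      using g2 that \<open>(j, l) \<in> P\<close> by blast
    ultimately show ?thesis using wL that by (metis Suc_inject)
  qed
  have fresh: "v p \<noteq> w" if "p \<in> P" for p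
    using member_le_sum[of p P "\<lambda>p. snd (v p)"] that w(2) \<open>finite P\<close> by auto
  have lab_w: "y 0 k m = lab w m" if "m < N" for m
    using that w(3) by (simp add: lab_def overwrite_def)
  have "good B (insert (i, k) P) (v((i, k) := w)) y N"
    unfolding good_def
  proof (intro conjI allI impI)
    fix i' k' assume "(i', k') \<in> insert (i, k) P"
    then show "(v((i, k) := w)) (i', k') \<in> elems B i'" using g1 w(1) by auto
  next
    fix i' a b
    assume "(i', a) \<in> insert (i, k) P \<and> (i', b) \<in> insert (i, k) P \<and>
      (v((i, k) := w)) (i', a) = (v((i, k) := w)) (i', b)"
    then show "a = b" using g2[of i' a b] fresh by (auto split: if_splits)
  next
    fix i' a l assume "(i', a) \<in> insert (i, k) P \<and> (Suc i', l) \<in> insert (i, k) P"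
    then show "y (Suc i') l a = rel ((v((i, k) := w)) (i', a)) ((v((i, k) := w)) (Suc i', l))"
      using g3[of i' a l] up[of l] down[of i' a] by auto
  next
    fix a m assume "(0, a) \<in> insert (i, k) P \<and> m < N"
    then show "y 0 a m = lab ((v((i, k) := w)) (0, a)) m" using g4[of a m] lab_w by auto
  qed
  then show ?thesis by blast
qed

lemma good_extend:
  assumes B: "tower B" and "finite Q" and "finite P" and "good B P v y N"
  shows "\<exists>v'. good B (P \<union> Q) v' y N \<and> (\<forall>p\<in>P. v' p = v p)"
  using assms(2)
proof (induction Q rule: finite_induct)
  case empty
  then show ?case using assms(4) by auto
next
  case (insert q Q)
  then obtain v' where v': "good B (P \<union> Q) v' y N" "\<forall>p\<in>P. v' p = v p" by blast
  show ?case
  proof (cases "q \<in> P \<union> Q")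
    case True
    then have "P \<union> insert q Q = P \<union> Q" by blast
    then show ?thesis using v' by metis
  next
    case False
    obtain i k where q: "q = (i, k)" by (cases q)
    obtain w where "good B (insert (i, k) (P \<union> Q)) (v'((i, k) := w)) y N"
      using good_insert[OF B _ v'(1), of i k] False q \<open>finite P\<close> \<open>finite Q\<close> by auto
    moreover have "\<forall>p\<in>P. (v'((i, k) := w)) p = v p" using v'(2) False q by auto
    moreover have "P \<union> insert q Q = insert (i, k) (P \<union> Q)" using q by blast
    ultimately show ?thesis by metis
  qed
qed

definition struct_pt :: "(nat \<times> nat \<Rightarrow> elem) \<Rightarrow> pt" where
  "struct_pt v i k m = (if i = 0 then lab (v (0, k)) m else rel (v (i - 1, m)) (v (i, k)))"

definition grid :: "nat \<Rightarrow> (nat \<times> nat) set" where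
  "grid L = {..<L} \<times> {..<L}"

lemma good_struct_pt_iff:
  "good B P v (struct_pt v) N \<longleftrightarrow>
     (\<forall>i k. (i, k) \<in> P \<longrightarrow> v (i, k) \<in> elems B i) \<and>
     (\<forall>i k k'. (i, k) \<in> P \<and> (i, k') \<in> P \<and> v (i, k) = v (i, k') \<longrightarrow> k = k')"
  by (auto simp: good_def struct_pt_def)

lemma good_struct_pt: "good B P v y N \<Longrightarrow> good B P v (struct_pt v) M"
  unfolding good_struct_pt_iff by (auto simp: good_def)

lemma good_agree: "good B (grid L) v y L \<Longrightarrow> agree n L y (struct_pt v)"
  unfolding agree_def
proof (intro allI impI)
  fix i k m assume g: "good B (grid L) v y L" and "i < L" "k < L" "m < L"
  then show "y i k m = struct_pt v i k m"
    by (cases i) (auto simp: good_def grid_def struct_pt_def)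
qed

text \<open>First \<open>a\<close> is placed and a square of side \<open>L1\<close> is filled. Then
  \<open>forcing\<close> gives a pattern \<open>y'\<close> for \<open>D t\<close> that respects the
  labels already in use, and \<open>y'\<close> is realised on a square of side
  \<open>L'\<close>.\<close>

lemma generic_extension:
  assumes B: "tower B" and good: "good B (grid L) v (struct_pt v) 0" and a: "a \<in> elems B i"
  shows "\<exists>L' v'. L < L' \<and> i < L' \<and> good B (grid L') v' (struct_pt v') 0 \<and> (\<forall>p\<in>grid L. v' p = v p) \<and>
     forced n (D t) L' (struct_pt v') \<and> (\<exists>k<L'. v' (i, k) = a)"
proof -
  have fin: "finite (grid L)" for L by (simp add: grid_def)
  obtain L1 v1 where 1: "L < L1" "i < L1" "good B (grid L1) v1 (struct_pt v1) 0" "\<forall>p\<in>grid L. v1 p = v p"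
    "\<exists>k<L1. v1 (i, k) = a"
  proof -
    define P where "P = (if \<exists>k. (i, k) \<in> grid L \<and> v (i, k) = a then grid L else insert (i, L) (grid L))"
    define v0 where "v0 = (if \<exists>k. (i, k) \<in> grid L \<and> v (i, k) = a then v else v((i, L) := a))"
    have g: "good B P v0 (struct_pt v0) 0"
      using good a unfolding good_struct_pt_iff P_def v0_def by (auto simp: grid_def)
    have v0: "\<forall>p\<in>grid L. v0 p = v p" "grid L \<subseteq> P" by (auto simp: v0_def P_def grid_def)
    have "finite P" using fin by (simp add: P_def)
    from good_extend[OF B fin[of "Suc (max i L)"] this g]
    obtain v1 where v1: "good B (P \<union> grid (Suc (max i L))) v1 (struct_pt v0) 0" "\<forall>p\<in>P. v1 p = v0 p" by blast
    have "P \<subseteq> grid (Suc (max i L))" by (auto simp: P_def grid_def)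
    then have "good B (grid (Suc (max i L))) v1 (struct_pt v1) 0"
      using good_struct_pt[OF v1(1)] by (simp add: Un_absorb1)
    moreover have "\<exists>k<Suc (max i L). v1 (i, k) = a"
    proof (cases "\<exists>k. (i, k) \<in> grid L \<and> v (i, k) = a")
      case True
      then obtain k where "(i, k) \<in> grid L" "v (i, k) = a" by blast
      then show ?thesis using v1(2) v0 by (intro exI[of _ k]) (auto simp: grid_def)
    next
      case False
      then have "(i, L) \<in> P" "v0 (i, L) = a" by (auto simp: P_def v0_def)
      then show ?thesis using v1(2) by (intro exI[of _ L]) auto
    qed
    moreover have "\<forall>p\<in>grid L. v1 p = v p" using v1(2) v0 by auto
    ultimately show ?thesis by (intro that[of "Suc (max i L)" v1]) auto
  qed
  have "inj_on (\<lambda>k. elem_code (v1 (0, k))) {..<L1}"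
  proof (rule inj_onI)
    fix k l assume kl: "k \<in> {..<L1}" "l \<in> {..<L1}" "elem_code (v1 (0, k)) = elem_code (v1 (0, l))"
    then have pos: "(0, k) \<in> grid L1" "(0, l) \<in> grid L1" using 1(1) by (auto simp: grid_def)
    then have "v1 (0, k) \<in> elems B 0" "v1 (0, l) \<in> elems B 0"
      using 1(3) unfolding good_struct_pt_iff by blast+
    then have "v1 (0, k) = v1 (0, l)"
      using B kl(3) by (intro inj_onD[OF elem_code_inj]) (auto simp: elems_def tower_def)
    then show "k = l" using 1(3) pos unfolding good_struct_pt_iff by blast
  qed
  from forcing[OF this, of "\<lambda>k. stem (snd (v1 (0, k)))" "struct_pt v1" t]
  obtain L' y' where y': "L' \<ge> L1" "\<forall>k<L1. \<forall>m<L'. y' 0 k m = lab (v1 (0, k)) m"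
    "\<forall>i<L1. \<forall>k<L1. \<forall>m<L1. 0 < i \<longrightarrow> y' i k m = struct_pt v1 i k m" "forced n (D t) L' y'"
    unfolding lab_def by blast
  \<comment> \<open>The old labels follow \<open>y'\<close> up to \<open>L'\<close>, so the bit
    bound rises from 0 to \<open>L'\<close>; elements added next get stems of that length.\<close>
  have "good B (grid L1) v1 y' L'"
    using 1(3) y'(2,3) unfolding good_struct_pt_iff unfolding good_def
    by (auto simp: grid_def struct_pt_def)
  from good_extend[OF B fin[of L'] fin this]
  obtain v' where v': "good B (grid L1 \<union> grid L') v' y' L'" "\<forall>p\<in>grid L1. v' p = v1 p" by blast
  have "grid L1 \<union> grid L' = grid L'" using y'(1) by (auto simp: grid_def)
  then have g': "good B (grid L') v' y' L'" using v'(1) by simp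
  have "forced n (D t) L' (struct_pt v')" using forced_cong[OF good_agree[OF g'] y'(4)] .
  moreover have "\<exists>k<L'. v' (i, k) = a"
    using 1(2,5) v'(2) y'(1) by (auto simp: grid_def intro: less_le_trans)
  moreover have "\<forall>p\<in>grid L. v' p = v p" using 1(1,4) v'(2) by (auto simp: grid_def)
  ultimately show ?thesis using good_struct_pt[OF g', of 0] 1(1,2) y'(1)
    by - (rule exI[of _ L'], rule exI[of _ v'], simp)
qed

end

text \<open>The demands on labels form a countable family of dense open requirements on finite
  tuples of reals, to which \<open>mycielski\<close> applies.\<close>

lemma generic_labels_exist:
  fixes D :: "nat \<Rightarrow> pt set"
  assumes dense: "\<And>t L y. \<exists>L'\<ge>L. \<exists>y'. agree n L y y' \<and> forced n (D t) L' y'"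
  shows "\<exists>\<phi> \<psi>. generic_labels n D \<phi> \<psi>"
proof -
  have dense': "\<exists>L'\<ge>L. \<exists>y'. (\<forall>i<L. \<forall>k<L. \<forall>m<L. y' i k m = y i k m) \<and> forced n (D t) L' y'" for t L y
  proof -
    obtain L' y' where y': "L' \<ge> L" "agree n L y y'" "forced n (D t) L' y'" using dense by blast
    \<comment> \<open>\<open>forced\<close> ignores the levels outside \<open>n\<close>, so there
      \<open>y\<close> can be restored.\<close>
    define y'' where "y'' i = (if enat i < n then y' i else y i)" for i
    have "agree n L' y' y''" by (simp add: agree_def y''_def)
    then have "forced n (D t) L' y''" using y'(3) by (rule forced_cong)
    moreover have "\<forall>i<L. \<forall>k<L. \<forall>m<L. y'' i k m = y i k m"
      using y'(2) by (simp add: agree_def y''_def)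
    ultimately show ?thesis using y'(1) by blast
  qed
  \<comment> \<open>\<open>Inl N\<close> asks two reals to differ beyond \<open>N\<close>;
    \<open>Inr\<close> asks for an instance of \<open>forcing\<close>. Coding its pattern and stems
    by finite lists keeps the index type countable.\<close>
  define ar :: "nat + nat \<times> nat \<times> (nat \<times> nat \<times> nat) list \<times> bool list list \<Rightarrow> nat"
    where "ar r = (case r of Inl N \<Rightarrow> 2 | Inr (t, L, gl, ws) \<Rightarrow> L)" for r
  define U :: "nat + nat \<times> nat \<times> (nat \<times> nat \<times> nat) list \<times> bool list list \<Rightarrow> (nat \<Rightarrow> nat \<Rightarrow> bool) \<Rightarrow> bool"
    where "U r q = (case r of Inl N \<Rightarrow> \<exists>b\<ge>N. q 0 b \<noteq> q 1 b
      | Inr (t, L, gl, ws) \<Rightarrow> \<exists>L'\<ge>L. \<exists>y'. (\<forall>k<L. \<forall>m<L'. y' 0 k m = overwrite (ws ! k) (q k) m) \<and>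
        (\<forall>i<L. \<forall>k<L. \<forall>m<L. 0 < i \<longrightarrow> y' i k m = ((i, k, m) \<in> set gl)) \<and> forced n (D t) L' y')" for r q
  have "\<exists>q' m'. (\<forall>k<ar r. \<forall>b<m. q' k b = q k b) \<and>
      (\<forall>q''. (\<forall>k<ar r. \<forall>b<m'. q'' k b = q' k b) \<longrightarrow> U r q'')" for r q m
  proof (cases r)
    case (Inl N)
    define q' where "q' k b = (if b < m then q k b else k = 0)" for k :: nat and b
    have "U r q''" if "\<forall>k<ar r. \<forall>b<Suc (max m N). q'' k b = q' k b" for q''
      using that unfolding U_def ar_def Inl by (auto simp: q'_def intro!: exI[of _ "max m N"])
    then show ?thesis by (intro exI[of _ q'] exI[of _ "Suc (max m N)"]) (auto simp: q'_def)
  next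
    case (Inr p)
    obtain t L gl ws where r: "r = Inr (t, L, gl, ws)" using Inr by (cases p) auto
    \<comment> \<open>\<open>L0\<close> covers the stems and the \<open>m\<close> protected bits, so
      the extension \<open>y'\<close> reproduces both.\<close>
    define L0 where "L0 = L + m + (\<Sum>k<L. length (ws ! k))"
    have L0: "length (ws ! k) \<le> L0" if "k < L" for k
      using member_le_sum[of k "{..<L}" "\<lambda>k. length (ws ! k)"] that by (simp add: L0_def)
    define y where "y i k m = (if i = 0 then overwrite (ws ! k) (q k) m else (i, k, m) \<in> set gl)" for i k m
    obtain L' y' where y': "L' \<ge> L0" "\<And>i k m. i < L0 \<Longrightarrow> k < L0 \<Longrightarrow> m < L0 \<Longrightarrow> y' i k m = y i k m"
      "forced n (D t) L' y'"
      using dense'[of L0 y t] by blast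
    \<comment> \<open>Bits hidden under a stem stay those of \<open>q\<close>; the others are read
      off from \<open>y'\<close>.\<close>
    define q' where "q' k b = (if b < length (ws ! k) then q k b else y' 0 k b)" for k b
    have "q' k b = q k b" if "k < L" "b < m" for k b
      using that y'(2)[of 0 k b] by (auto simp: q'_def y_def overwrite_def L0_def)
    moreover have "U r q''" if q'': "\<forall>k<L. \<forall>b<L'. q'' k b = q' k b" for q''
    proof -
      have "y' 0 k b = overwrite (ws ! k) (q'' k) b" if "k < L" "b < L'" for k b
      proof (cases "b < length (ws ! k)")
        case True
        then have "b < L0" "k < L0" "0 < L0" using L0[OF that(1)] that by (auto simp: L0_def)
        then show ?thesis using y'(2)[of 0 k b] True by (simp add: y_def overwrite_def)
      next
        case False
        then show ?thesis using q'' that by (simp add: overwrite_def q'_def)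
      qed
      moreover have "y' i k b = ((i, k, b) \<in> set gl)" if "i < L" "k < L" "b < L" "0 < i" for i k b
        using y'(2)[of i k b] that by (simp add: L0_def y_def)
      moreover have "L' \<ge> L" using y'(1) by (simp add: L0_def)
      ultimately show ?thesis using y'(3) unfolding U_def r
        by - (simp, rule exI[of _ L'], simp, rule exI[of _ y'], simp)
    qed
    ultimately show ?thesis by (intro exI[of _ q'] exI[of _ L']) (simp add: ar_def r)
  qed
  from mycielski[of "\<lambda>j. ar (from_nat j)" "\<lambda>j. U (from_nat j)", OF this]
  obtain \<phi> :: "(nat \<Rightarrow> bool) \<Rightarrow> nat \<Rightarrow> bool" and \<psi> where \<phi>: "\<forall>z b. \<phi> z b = \<psi> b (map z [0..<Suc b])"
    and gen: "\<forall>j z. inj_on z {..<ar (from_nat j)} \<longrightarrow> U (from_nat j) (\<lambda>k. \<phi> (z k))"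
    by (elim exE conjE)
  have gen': "U r (\<lambda>k. \<phi> (z k))" if "inj_on z {..<ar r}" for r z
    using gen[rule_format, of z "to_nat r"] that by simp
  have "generic_labels n D \<phi> \<psi>"
  proof
    show "\<phi> z b = \<psi> b (map z [0..<Suc b])" for z b by (rule \<phi>[rule_format])
    show "\<exists>b\<ge>N. \<phi> z b \<noteq> \<phi> z' b" if "z \<noteq> z'" for z z' N
    proof -
      have "inj_on (\<lambda>k. if k = 0 then z else z') {..<2::nat}"
        using that by (auto simp: inj_on_def split: if_splits)
      then show ?thesis using gen'[of "\<lambda>k. if k = 0 then z else z'" "Inl N"] by (auto simp: ar_def U_def)
    qed
    fix s :: "nat \<Rightarrow> nat \<Rightarrow> bool" and L :: nat and w :: "nat \<Rightarrow> bool list" and g :: pt and t :: nat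
    assume inj: "inj_on s {..<L}"
    have "finite {p \<in> {..<L} \<times> {..<L} \<times> {..<L}. g (fst p) (fst (snd p)) (snd (snd p))}" by simp
    then obtain gl where gl: "set gl = {p \<in> {..<L} \<times> {..<L} \<times> {..<L}. g (fst p) (fst (snd p)) (snd (snd p))}"
      using finite_list by blast
    have "U (Inr (t, L, gl, map w [0..<L])) (\<lambda>k. \<phi> (s k))"
      using inj by (intro gen') (simp add: ar_def)
    then show "\<exists>L'\<ge>L. \<exists>y'. (\<forall>k<L. \<forall>m<L'. y' 0 k m = overwrite (w k) (\<phi> (s k)) m) \<and>
        (\<forall>i<L. \<forall>k<L. \<forall>m<L. 0 < i \<longrightarrow> y' i k m = g i k m) \<and> forced n (D t) L' y'"
      unfolding U_def by (simp add: gl cong: conj_cong)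
  qed
  then show ?thesis by blast
qed

section \<open>The sets coded by a point\<close>

text \<open>Cumulative because a \<open>tower\<close> must increase; \<open>aa_rank_unique\<close>
  separates the ranks again.\<close>

definition levels :: "pt \<Rightarrow> nat \<Rightarrow> hs set" where
  "levels x i = (\<Union>j\<le>i. range (aa x j))"

lemma rcset_aa_Suc: "rcset (acset {aa x j k | k. P k}) = {aa x j k | k. P k}"
proof -
  have "{aa x j k | k. P k} = aa x j ` {k. P k}" by auto
  then have "countable {aa x j k | k. P k}" by simp
  then show ?thesis by simp
qed

lemma levels_Suc: "levels x (Suc i) = levels x i \<union> range (aa x (Suc i))"
  unfolding levels_def atMost_Suc by blast

lemma range_aa_subset_levels: "range (aa x i) \<subseteq> levels x i"
  unfolding levels_def by blast

lemma tower_levels: "tower (levels x)"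
  unfolding tower_def
proof (intro conjI allI ballI)
  show "levels x 0 \<noteq> {}" "levels x 0 \<subseteq> range Atom" by (auto simp: levels_def)
  fix i
  show "countable (levels x i)" by (simp add: levels_def)
  show "levels x i \<subseteq> levels x (Suc i)" by (simp add: levels_Suc)
  fix f assume "f \<in> levels x (Suc i)"
  then consider "f \<in> levels x i" | l where "f = aa x (Suc i) l"
    unfolding levels_Suc by blast
  then show "admissible (levels x i) f"
  proof cases
    case (2 l)
    have "rcset (acset {aa x i k | k. x (Suc i) l k}) \<subseteq> levels x i"
      unfolding rcset_aa_Suc using range_aa_subset_levels by blast
    then show ?thesis unfolding admissible_def 2 aa.simps by blast
  qed (simp add: admissible_def)
qed

lemma XsetD:
  assumes "x \<in> Xset n" "enat (Suc i) < n"
  shows "\<exists>k. x (Suc i) k m" "\<exists>m. x (Suc i) k m"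
proof -
  have "1 \<le> Suc i \<and> enat (Suc i) < n" using assms by simp
  note mp[OF spec[OF conjunct2[OF CollectD[OF assms(1)[unfolded Xset_def]]]] this]
  then show "\<exists>k. x (Suc i) k m" "\<exists>m. x (Suc i) k m" by blast+
qed

lemma enat_less_Suc_trans: "enat (Suc i) < n \<Longrightarrow> enat i < n"
  by (meson enat_ord_simps(2) lessI less_trans)

text \<open>The second clause of \<open>Xset\<close> makes every coded set nonempty, so the rank is
  found by descending through members to an atom.\<close>

lemma aa_rank_unique:
  assumes "x \<in> Xset n" "y \<in> Xset n"
  shows "enat i < n \<Longrightarrow> enat j < n \<Longrightarrow> aa x i k = aa y j l \<Longrightarrow> i = j"
proof (induction i arbitrary: j k l)
  case 0
  then show ?case by (cases j) auto
next
  case (Suc i)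
  then obtain j' where j: "j = Suc j'" by (cases j) auto
  obtain m where m: "x (Suc i) k m" using XsetD(2)[OF assms(1) Suc.prems(1)] by blast
  have "rcset (acset {aa x i m | m. x (Suc i) k m}) = rcset (acset {aa y j' m | m. y (Suc j') l m})"
    using Suc.prems(3) j by simp
  then have "{aa x i m | m. x (Suc i) k m} = {aa y j' m | m. y (Suc j') l m}" unfolding rcset_aa_Suc .
  then obtain m' where "aa x i m = aa y j' m'" using m by blast
  then show ?case using Suc.IH Suc.prems j enat_less_Suc_trans by blast
qed

text \<open>By the first clause of \<open>Xset\<close>, everything of rank \<open>i\<close> is a
  member of some set of the next rank.\<close>

lemma range_aa_pred:
  assumes "x \<in> Xset n" "enat (Suc i) < n"
  shows "range (aa x i) = \<Union> (rcset ` {S. HSet S \<in> range (aa x (Suc i))})"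
proof (intro equalityI subsetI)
  fix h assume "h \<in> range (aa x i)"
  then obtain m where m: "h = aa x i m" by blast
  obtain k where "x (Suc i) k m" using XsetD(1)[OF assms] by blast
  then have "h \<in> rcset (acset {aa x i m | m. x (Suc i) k m})" unfolding rcset_aa_Suc using m by blast
  moreover have "HSet (acset {aa x i m | m. x (Suc i) k m}) \<in> range (aa x (Suc i))" by auto
  ultimately show "h \<in> \<Union> (rcset ` {S. HSet S \<in> range (aa x (Suc i))})" by blast
next
  fix h assume "h \<in> \<Union> (rcset ` {S. HSet S \<in> range (aa x (Suc i))})"
  then obtain k where "h \<in> rcset (acset {aa x i m | m. x (Suc i) k m})" by auto
  then show "h \<in> range (aa x i)" unfolding rcset_aa_Suc by auto
qed

lemma AA_Suc_eq_iff: "AA x (Suc i) = AA y (Suc i) \<longleftrightarrow> range (aa x i) = range (aa y i)"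
  by (simp add: AA_def acset_inject)

text \<open>For finite \<open>n\<close>, \<open>FF\<close> compares the top range only;
  \<open>range_aa_pred\<close> recovers the lower ones by unions.\<close>

lemma FF_iff_ranges:
  assumes n: "1 \<le> n" and x: "x \<in> Xset n" and y: "y \<in> Xset n"
  shows "FF n x y \<longleftrightarrow> (\<forall>i. enat i < n \<longrightarrow> range (aa x i) = range (aa y i))"
proof (cases n)
  case (enat m)
  then obtain m' where m': "m = Suc m'" using n by (cases m) (auto simp: one_enat_def)
  have "range (aa x i) = range (aa y i)" if "range (aa x m') = range (aa y m')" "i \<le> m'" for i
    using that(2)
  proof (induction rule: inc_induct)
    case (step i)
    then have "enat (Suc i) < n" using enat m' by simp
    then show ?case using step.IH range_aa_pred[OF x] range_aa_pred[OF y] by metis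
  qed (rule that(1))
  then have "range (aa x m') = range (aa y m') \<longleftrightarrow> (\<forall>i\<le>m'. range (aa x i) = range (aa y i))"
    by blast
  then show ?thesis using enat m' by (simp add: FF_def AA_Suc_eq_iff less_Suc_eq_le)
next
  case infinity
  have "(\<forall>j\<ge>1. AA x j = AA y j) \<longleftrightarrow> (\<forall>i. AA x (Suc i) = AA y (Suc i))"
  proof (intro iffI allI impI)
    fix j :: nat assume "\<forall>i. AA x (Suc i) = AA y (Suc i)" "1 \<le> j"
    then show "AA x j = AA y j" by (cases j) auto
  qed auto
  then show ?thesis using infinity by (simp add: FF_def AA_Suc_eq_iff)
qed

text \<open>By uniqueness of rank, the sets of rank exactly \<open>i\<close> can be split off from a
  cumulative level, whichever point codes it.\<close>

lemma FF_iff_levels: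
  assumes n: "1 \<le> n" and x: "x \<in> Xset n" and y: "y \<in> Xset n"
  shows "FF n x y \<longleftrightarrow> (\<forall>i. enat i < n \<longrightarrow> levels x i = levels y i)"
  unfolding FF_iff_ranges[OF assms]
proof (intro iffI allI impI)
  fix i assume "\<forall>i. enat i < n \<longrightarrow> range (aa x i) = range (aa y i)" "enat i < n"
  then have "range (aa x j) = range (aa y j)" if "j \<le> i" for j
    using that by (meson enat_ord_simps(1) le_less_trans)
  then show "levels x i = levels y i" by (simp add: levels_def)
next
  have sub: "range (aa x i) \<subseteq> range (aa y i)" if "levels x i = levels y i" "enat i < n"
    and "x \<in> Xset n" "y \<in> Xset n" for x y i
  proof
    fix h assume "h \<in> range (aa x i)"
    then obtain k where k: "h = aa x i k" by blast
    then have "h \<in> levels y i" unfolding that(1)[symmetric] using range_aa_subset_levels by blast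
    then obtain j l where j: "j \<le> i" "h = aa y j l" by (auto simp: levels_def)
    then have "enat j < n" using that(2) by (meson enat_ord_simps(1) le_less_trans)
    then have "i = j" using aa_rank_unique[OF that(3,4,2)] k j by metis
    then show "h \<in> range (aa y i)" using j by simp
  qed
  fix i assume "\<forall>i. enat i < n \<longrightarrow> levels x i = levels y i" "enat i < n"
  then have "levels x i = levels y i" by simp
  then show "range (aa x i) = range (aa y i)"
    using sub[of x i y] sub[of y i x] \<open>enat i < n\<close> x y by auto
qed

section \<open>Generic enumerations\<close>

text \<open>Indices into \<open>x\<close> replace the sets themselves. Names and states thus form
  countable types, and stages can be chosen by least code.\<close>

type_synonym name = "(nat \<times> nat) list \<times> nat"
type_synonym state = "nat \<times> name list list"

definition denote :: "pt \<Rightarrow> name \<Rightarrow> elem" where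
  "denote x a = (map (\<lambda>p. aa x (fst p) (snd p)) (fst a), snd a)"

definition valid :: "nat \<Rightarrow> name \<Rightarrow> bool" where
  "valid i a \<longleftrightarrow> (\<forall>p\<in>set (fst a). fst p \<le> i)"

lemma denote_in_elems: "valid i a \<Longrightarrow> denote x a \<in> elems (levels x) i"
  by (auto simp: valid_def denote_def elems_def levels_def)

lemma elems_named:
  assumes "v \<in> elems (levels x) i"
  shows "\<exists>a. valid i a \<and> denote x a = v"
proof -
  have "\<forall>f\<in>set (fst v). \<exists>p. fst p \<le> i \<and> aa x (fst p) (snd p) = f"
    using assms by (fastforce simp: elems_def levels_def)
  then obtain p where p: "\<And>f. f \<in> set (fst v) \<Longrightarrow> fst (p f) \<le> i \<and> aa x (fst (p f)) (snd (p f)) = f" by metis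
  then have "map (\<lambda>f. aa x (fst (p f)) (snd (p f))) (fst v) = fst v" by (simp add: map_idI)
  then have "denote x (map p (fst v), snd v) = v" by (simp add: denote_def comp_def)
  moreover have "valid i (map p (fst v), snd v)" using p by (auto simp: valid_def)
  ultimately show ?thesis by blast
qed

definition name_at :: "state \<Rightarrow> nat \<times> nat \<Rightarrow> name" where
  "name_at s p = snd s ! fst p ! snd p"

lemma state_ex: "\<exists>s. fst s = L \<and> (\<forall>i<L. \<forall>k<L. name_at s (i, k) = f (i, k))"
  by (rule exI[of _ "(L, map (\<lambda>i. map (\<lambda>k. f (i, k)) [0..<L]) [0..<L])"]) (simp add: name_at_def)

context generic_labels
begin

definition state_ok :: "pt \<Rightarrow> state \<Rightarrow> bool" where
  "state_ok x s \<longleftrightarrow> (\<forall>i<fst s. \<forall>k<fst s. valid i (name_at s (i, k))) \<and>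
     (\<forall>i<fst s. \<forall>k<fst s. \<forall>k'<fst s. k \<noteq> k' \<longrightarrow> denote x (name_at s (i, k)) \<noteq> denote x (name_at s (i, k')))"

text \<open>Stage \<open>t\<close> both forces \<open>D t\<close> and lists the element named by the
  pair that \<open>t\<close> codes, which makes the enumeration onto.\<close>

definition step_ok :: "nat \<Rightarrow> pt \<Rightarrow> state \<Rightarrow> state \<Rightarrow> bool" where
  "step_ok t x s s' \<longleftrightarrow> fst s < fst s' \<and> (\<forall>i<fst s. \<forall>k<fst s. name_at s' (i, k) = name_at s (i, k)) \<and>
     state_ok x s' \<and> forced n (D t) (fst s') (struct_pt (\<lambda>p. denote x (name_at s' p))) \<and>
     (case from_nat t of (i, a) \<Rightarrow> valid i a \<longrightarrow> i < fst s' \<and> (\<exists>k<fst s'. denote x (name_at s' (i, k)) = denote x a))"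

lemma step_ok_ex:
  assumes "state_ok x s"
  shows "\<exists>s'. step_ok t x s s'"
proof -
  obtain i a where t: "from_nat t = (i :: nat, a :: name)" by (cases "from_nat t :: nat \<times> name")
  \<comment> \<open>\<open>([], 0)\<close> is valid at every level and stands in when
    \<open>a\<close> is not valid at level \<open>i\<close>.\<close>
  define a' where "a' = (if valid i a then a else ([], 0))"
  have a': "valid i a'" by (simp add: a'_def valid_def)
  let ?v = "\<lambda>p. denote x (name_at s p)"
  have "good (levels x) (grid (fst s)) ?v (struct_pt ?v) 0"
    unfolding good_struct_pt_iff
  proof (intro conjI allI impI)
    fix i k assume "(i, k) \<in> grid (fst s)"
    then show "denote x (name_at s (i, k)) \<in> elems (levels x) i"
      using assms by (intro denote_in_elems) (simp add: state_ok_def grid_def)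
  next
    fix i k k'
    assume "(i, k) \<in> grid (fst s) \<and> (i, k') \<in> grid (fst s) \<and> denote x (name_at s (i, k)) = denote x (name_at s (i, k'))"
    then have "i < fst s" "k < fst s" "k' < fst s" "denote x (name_at s (i, k)) = denote x (name_at s (i, k'))"
      by (auto simp: grid_def)
    then show "k = k'" using assms unfolding state_ok_def by blast
  qed
  from generic_extension[OF tower_levels this denote_in_elems[OF a'], of t]
  obtain L' v' where L': "fst s < L'" "i < L'" "good (levels x) (grid L') v' (struct_pt v') 0"
    "\<forall>p\<in>grid (fst s). v' p = denote x (name_at s p)" "forced n (D t) L' (struct_pt v')"
    "\<exists>k<L'. v' (i, k) = denote x a'" by blast
  have "\<exists>b. valid (fst p) b \<and> denote x b = v' p" if "p \<in> grid L'" for p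
    using elems_named[of "v' p" x "fst p"] L'(3) that unfolding good_struct_pt_iff by (cases p) auto
  then obtain b where b: "\<And>p. p \<in> grid L' \<Longrightarrow> valid (fst p) (b p) \<and> denote x (b p) = v' p" by metis
  \<comment> \<open>Old positions keep their very names, not merely their elements.\<close>
  define f where "f p = (if p \<in> grid (fst s) then name_at s p else b p)" for p
  have fv: "valid (fst p) (f p) \<and> denote x (f p) = v' p" if "p \<in> grid L'" for p
    using b[OF that] L'(4) assms by (auto simp: f_def state_ok_def grid_def)
  obtain s' where s': "fst s' = L'" "\<And>i k. i < L' \<Longrightarrow> k < L' \<Longrightarrow> name_at s' (i, k) = f (i, k)"
    using state_ex by metis
  have name_at: "valid i (name_at s' (i, k))" "denote x (name_at s' (i, k)) = v' (i, k)" if "i < L'" "k < L'" for i k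
    using fv[of "(i, k)"] s'(2)[OF that] that by (auto simp: grid_def)
  have "step_ok t x s s'"
    unfolding step_ok_def
  proof (intro conjI)
    show "fst s < fst s'" using L' s' by simp
    show "\<forall>i<fst s. \<forall>k<fst s. name_at s' (i, k) = name_at s (i, k)"
      using s'(2) L'(1) by (simp add: f_def grid_def)
    show "state_ok x s'" unfolding state_ok_def
    proof (intro conjI allI impI)
      fix i k k' assume *: "i < fst s'" "k < fst s'" "k' < fst s'" "k \<noteq> k'"
      then have "v' (i, k) \<noteq> v' (i, k')"
        using L'(3) s'(1) unfolding good_struct_pt_iff by (auto simp: grid_def)
      then show "denote x (name_at s' (i, k)) \<noteq> denote x (name_at s' (i, k'))" using name_at * s'(1) by simp
    qed (use name_at s'(1) in simp)
    have "agree n L' (struct_pt v') (struct_pt (\<lambda>p. denote x (name_at s' p)))"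
      using name_at by (auto simp: agree_def struct_pt_def)
    then show "forced n (D t) (fst s') (struct_pt (\<lambda>p. denote x (name_at s' p)))"
      using L'(5) s'(1) forced_cong by blast
    show "case from_nat t of (i, a) \<Rightarrow> valid i a \<longrightarrow> i < fst s' \<and> (\<exists>k<fst s'. denote x (name_at s' (i, k)) = denote x a)"
      using L'(2,6) name_at(2) s'(1) t by (auto simp: a'_def)
  qed
  then show ?thesis by blast
qed

section \<open>Stages chosen by least code and their limit\<close>

fun stage_code :: "nat \<Rightarrow> pt \<Rightarrow> nat" where
  "stage_code 0 x = to_nat ((0, []) :: state)"
| "stage_code (Suc t) x = (LEAST e. step_ok t x (from_nat (stage_code t x)) (from_nat e))"

definition stage :: "nat \<Rightarrow> pt \<Rightarrow> state" where
  "stage t x = from_nat (stage_code t x)"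

lemma stage_Suc: "state_ok x (stage t x) \<Longrightarrow> step_ok t x (stage t x) (stage (Suc t) x)"
proof -
  assume "state_ok x (stage t x)"
  from step_ok_ex[OF this, of t] obtain s' where "step_ok t x (stage t x) s'" by blast
  then have "step_ok t x (stage t x) (from_nat (to_nat s'))" by simp
  then show ?thesis unfolding stage_def stage_code.simps(2) by (rule LeastI)
qed

lemma stage_ok: "state_ok x (stage t x)"
proof (induction t)
  case 0
  then show ?case by (simp add: stage_def state_ok_def)
next
  case (Suc t)
  then show ?case using stage_Suc[of x t] by (simp add: step_ok_def)
qed

lemmas stage_step = stage_Suc[OF stage_ok]

lemma stage_mono: "t \<le> t' \<Longrightarrow> fst (stage t x) \<le> fst (stage t' x) \<and>
    (\<forall>i<fst (stage t x). \<forall>k<fst (stage t x). name_at (stage t' x) (i, k) = name_at (stage t x) (i, k))"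
proof (induction rule: dec_induct)
  case (step u)
  then show ?case using stage_step[where x=x and t=u] by (auto simp: step_ok_def)
qed simp

lemma stage_size: "t \<le> fst (stage t x)"
proof (induction t)
  case (Suc t)
  then show ?case using stage_step[where x=x and t=t] by (auto simp: step_ok_def)
qed simp

text \<open>Stage \<open>t\<close> fills a square of side at least \<open>t\<close>, so stage
  \<open>Suc (i + k)\<close> contains position \<open>(i, k)\<close>, whose name is final.\<close>

definition enum_name :: "pt \<Rightarrow> nat \<times> nat \<Rightarrow> name" where
  "enum_name x p = name_at (stage (Suc (fst p + snd p)) x) p"

definition enum :: "pt \<Rightarrow> nat \<times> nat \<Rightarrow> elem" where
  "enum x p = denote x (enum_name x p)"

lemma enum_name_eq:
  assumes "i < fst (stage t x)" "k < fst (stage t x)"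
  shows "enum_name x (i, k) = name_at (stage t x) (i, k)"
proof -
  have "i < fst (stage (Suc (i + k)) x)" "k < fst (stage (Suc (i + k)) x)"
    using stage_size[of "Suc (i + k)" x] by auto
  then show ?thesis
    using stage_mono[of t "Suc (i + k)" x] stage_mono[of "Suc (i + k)" t x] assms
    by (cases "t \<le> Suc (i + k)") (auto simp: enum_name_def)
qed

lemma enum_in_elems: "enum x (i, k) \<in> elems (levels x) i"
proof -
  have "Suc (i + k) \<le> fst (stage (Suc (i + k)) x)" by (rule stage_size)
  then show ?thesis unfolding enum_def enum_name_def
    using stage_ok[of x "Suc (i + k)"] by (intro denote_in_elems) (simp add: state_ok_def)
qed

lemma enum_inj: "enum x (i, k) = enum x (i, k') \<Longrightarrow> k = k'"
proof (rule ccontr)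
  assume eq: "enum x (i, k) = enum x (i, k')" and "k \<noteq> k'"
  define t where "t = Suc (i + k + k')"
  have "i < fst (stage t x)" "k < fst (stage t x)" "k' < fst (stage t x)"
    using stage_size[of t x] by (auto simp: t_def)
  then show False using stage_ok[of x t] eq \<open>k \<noteq> k'\<close> by (auto simp: state_ok_def enum_def enum_name_eq)
qed

lemma enum_surj: "v \<in> elems (levels x) i \<Longrightarrow> \<exists>k. enum x (i, k) = v"
proof -
  assume "v \<in> elems (levels x) i"
  then obtain a where a: "valid i a" "denote x a = v" using elems_named by blast
  define t where "t = to_nat (i, a)"
  obtain k where "i < fst (stage (Suc t) x)" "k < fst (stage (Suc t) x)" "denote x (name_at (stage (Suc t) x) (i, k)) = v"
    using stage_step[where x=x and t=t] a by (auto simp: step_ok_def t_def)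
  then have "enum x (i, k) = v" unfolding enum_def by (simp add: enum_name_eq[of i "Suc t"])
  then show ?thesis by blast
qed

lemma range_enum: "range (\<lambda>k. enum x (i, k)) = elems (levels x) i"
  using enum_in_elems enum_surj by blast

section \<open>The new point and the reduction\<close>

definition generic_pt :: "pt \<Rightarrow> pt" where
  "generic_pt x i = (if enat i < n then struct_pt (enum x) i else undefined)"

lemma generic_pt_0: "enat 0 < n \<Longrightarrow> generic_pt x 0 k = lab (enum x (0, k))"
  by (rule ext) (simp add: generic_pt_def struct_pt_def)

lemma generic_pt_Suc: "enat (Suc i) < n \<Longrightarrow> generic_pt x (Suc i) k m = rel (enum x (i, m)) (enum x (Suc i, k))"
  by (simp add: generic_pt_def struct_pt_def)

lemma generic_pt_forced: "\<exists>L. forced n (D t) L (generic_pt x)"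
proof -
  let ?s = "stage (Suc t) x"
  have "forced n (D t) (fst ?s) (struct_pt (\<lambda>p. denote x (name_at ?s p)))"
    using stage_step[where x=x and t=t] by (simp add: step_ok_def)
  moreover have "agree n (fst ?s) (struct_pt (\<lambda>p. denote x (name_at ?s p))) (generic_pt x)"
    by (simp add: agree_def generic_pt_def struct_pt_def enum_def enum_name_eq[where t = "Suc t"])
  ultimately show ?thesis using forced_cong by blast
qed

lemma rel_above_ex: "u \<in> elems (levels x) i \<Longrightarrow> \<exists>v\<in>elems (levels x) (Suc i). rel u v"
  using elem_extension[OF tower_levels[of x], where \<A> = "{}" and \<L> = "{u}" and i = "Suc i" and \<beta> = "\<lambda>_. True"] by auto

lemma rel_below_ex: "v \<in> elems (levels x) (Suc i) \<Longrightarrow> \<exists>u\<in>elems (levels x) i. rel u v"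
  using elem_extension[OF tower_levels[of x], where \<A> = "{v}" and \<L> = "{}" and i = i and \<alpha> = "\<lambda>_. True"] by auto

text \<open>Distinct elements differ in their labels at level 0 and in their lower neighbours above
  it. The third clause of \<open>Xset\<close> follows at once.\<close>

lemma generic_pt_row_inj:
  assumes "enat i < n" "generic_pt x i k = generic_pt x i l"
  shows "k = l"
proof -
  have "enum x (i, k) = enum x (i, l)"
  proof (cases i)
    case 0
    have "set (fst v) \<subseteq> range Atom" if "v \<in> elems (levels x) 0" for v
      using that tower_levels[of x] by (auto simp: elems_def tower_def)
    moreover have "lab (enum x (0, k)) = lab (enum x (0, l))" using assms 0 by (simp add: generic_pt_0)
    ultimately show ?thesis using enum_in_elems[of x 0] unfolding 0 by (intro inj_onD[OF lab_inj]) blast+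
  next
    case (Suc j)
    have "rel (enum x (j, m)) (enum x (i, k)) = rel (enum x (j, m)) (enum x (i, l))" for m
      using fun_cong[OF assms(2), of m] assms(1) Suc by (simp add: generic_pt_Suc)
    then have "rel u (enum x (i, k)) = rel u (enum x (i, l))" if "u \<in> elems (levels x) j" for u
      using enum_surj[OF that] by metis
    moreover have "admissible (levels x j) f" if "f \<in> set (fst (enum x (i, a)))" for f a
      using enum_in_elems[of x i a] that Suc by (intro tower_admissible[OF tower_levels]) (auto simp: elems_def)
    ultimately show ?thesis using tower_nonempty[OF tower_levels, of x j]
      by (intro rel_below_inj[of "levels x j"]) (auto simp: elems_def)
  qed
  then show ?thesis by (rule enum_inj)
qed

lemma generic_pt_in_Xset: "generic_pt x \<in> Xset n"
  unfolding Xset_def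
proof (intro CollectI conjI allI impI)
  show "generic_pt x \<in> topspace (ambient_top n)" by (simp add: topspace_ambient_top generic_pt_def)
  fix i assume i: "1 \<le> i \<and> enat i < n"
  then obtain j where j: "i = Suc j" "enat (Suc j) < n" by (cases i) auto
  show "\<exists>k. generic_pt x i k m" for m
    using rel_above_ex[OF enum_in_elems[of x j m]] enum_surj[of _ x "Suc j"] j by (metis generic_pt_Suc)
  show "\<exists>m. generic_pt x i k m" for k
    using rel_below_ex[OF enum_in_elems[of x "Suc j" k]] enum_surj[of _ x j] j by (metis generic_pt_Suc)
  show "generic_pt x i k l1 = generic_pt x i k l2" if "generic_pt x (i - 1) l1 = generic_pt x (i - 1) l2" for k l1 l2
    using generic_pt_row_inj[of j x l1 l2] that j enat_less_Suc_trans by simp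
qed

text \<open>The enumeration exhausts each level, so the coded sets depend on the elements and not on
  their order.\<close>

lemma aa_generic_pt: "enat i < n \<Longrightarrow> aa (generic_pt x) i k = beta (levels x) i (enum x (i, k))"
proof (induction i arbitrary: k)
  case 0
  then show ?case by (simp add: generic_pt_0)
next
  case (Suc i)
  have "{aa (generic_pt x) i m | m. generic_pt x (Suc i) k m} = beta (levels x) i ` {w \<in> elems (levels x) i. rel w (enum x (Suc i, k))}"
    using Suc.IH[OF enat_less_Suc_trans[OF Suc.prems]] generic_pt_Suc[OF Suc.prems]
    unfolding range_enum[symmetric] by auto
  then show ?case by simp
qed

lemma range_aa_generic_pt: "enat i < n \<Longrightarrow> range (aa (generic_pt x) i) = beta (levels x) i ` elems (levels x) i"
  unfolding range_enum[symmetric] by (auto simp: aa_generic_pt)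

lemma generic_pt_reduces:
  assumes n: "1 \<le> n" and x: "x \<in> Xset n" and y: "y \<in> Xset n"
  shows "FF n x y \<longleftrightarrow> FF n (generic_pt x) (generic_pt y)"
proof -
  have "(\<forall>i. enat i < n \<longrightarrow> levels x i = levels y i) \<longleftrightarrow>
     (\<forall>i. enat i < n \<longrightarrow> beta (levels x) i ` elems (levels x) i = beta (levels y) i ` elems (levels y) i)"
  proof (intro iffI allI impI)
    fix i assume *: "\<forall>i. enat i < n \<longrightarrow> levels x i = levels y i" "enat i < n"
    then have "levels x j = levels y j" if "j \<le> i" for j
      using that by (meson enat_ord_simps(1) le_less_trans)
    then have "beta (levels x) i = beta (levels y) i" "elems (levels x) i = elems (levels y) i"
      using beta_cong[of i "levels x" "levels y"] elems_eq_iff[of "levels x" i "levels y"] by auto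
    then show "beta (levels x) i ` elems (levels x) i = beta (levels y) i ` elems (levels y) i" by simp
  next
    fix i
    assume "\<forall>i. enat i < n \<longrightarrow> beta (levels x) i ` elems (levels x) i = beta (levels y) i ` elems (levels y) i" "enat i < n"
    then show "levels x i = levels y i"
      using beta_images_determine[OF tower_levels tower_levels, where N = n] by blast
  qed
  then show ?thesis
    unfolding FF_iff_levels[OF n x y] FF_iff_ranges[OF n generic_pt_in_Xset generic_pt_in_Xset]
    using range_aa_generic_pt by simp
qed

end

section \<open>Borel measurability\<close>

text \<open>A measure serves as carrier of the Borel sets, which opens them to the method
  \<open>measurable\<close>.\<close>

definition Xborel :: "enat \<Rightarrow> pt measure" where
  "Xborel n = sigma (Xset n) {U. openin (Xtop n) U}"

lemma openin_Xtop_Pow: "{U. openin (Xtop n) U} \<subseteq> Pow (Xset n)"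
  using openin_subset[of "Xtop n"] by auto

lemma space_Xborel [simp]: "space (Xborel n) = Xset n"
  using openin_Xtop_Pow by (simp add: Xborel_def space_measure_of)

lemma sets_Xborel: "sets (Xborel n) = borel_sets_of (Xtop n)"
  using openin_Xtop_Pow by (simp add: Xborel_def borel_sets_of_def sets_measure_of)

lemma pred_Xborel_bit [measurable]: "Measurable.pred (Xborel n) (\<lambda>x. x i k m)"
proof (cases "enat i < n")
  case True
  have "{x \<in> Xset n. x i k m = True} \<in> sets (Xborel n)"
    unfolding sets_Xborel borel_sets_of_def
    by (rule sigma_sets.Basic) (simp add: openin_Xtop_bit[OF True] del: eq_True)
  then show ?thesis by (simp add: pred_def)
next
  case False
  \<comment> \<open>Outside \<open>n\<close> all points of \<open>Xset n\<close> have the same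
    value, so the predicate is constant.\<close>
  have "Measurable.pred (Xborel n) (\<lambda>x. x i k m) \<longleftrightarrow> Measurable.pred (Xborel n) (\<lambda>x. undefined k m)"
    using False by (intro measurable_cong) (simp add: Xset_def topspace_ambient_top)
  then show ?thesis by simp
qed

lemma setcompr_eq_iff:
  "{f m | m. P m} = {g m | m. Q m} \<longleftrightarrow>
    (\<forall>m. P m \<longrightarrow> (\<exists>m'. Q m' \<and> f m = g m')) \<and> (\<forall>m'. Q m' \<longrightarrow> (\<exists>m. P m \<and> f m = g m'))"
  (is "?A = ?B \<longleftrightarrow> ?P \<and> ?Q")
proof -
  have "?A \<subseteq> ?B \<longleftrightarrow> ?P" by auto
  moreover have "?B \<subseteq> ?A \<longleftrightarrow> ?Q"
  proof
    assume "?B \<subseteq> ?A"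
    then have "\<exists>m. g m' = f m \<and> P m" if "Q m'" for m' using that by auto
    then show ?Q by metis
  next
    assume ?Q
    then have "\<exists>m. g m' = f m \<and> P m" if "Q m'" for m' using that by metis
    then show "?B \<subseteq> ?A" by auto
  qed
  ultimately show ?thesis by (simp add: set_eq_subset)
qed

lemma aa_Suc_eq_iff:
  "aa x (Suc i) k = aa x (Suc j) l \<longleftrightarrow>
    (\<forall>m. x (Suc i) k m \<longrightarrow> (\<exists>m'. x (Suc j) l m' \<and> aa x i m = aa x j m')) \<and>
    (\<forall>m'. x (Suc j) l m' \<longrightarrow> (\<exists>m. x (Suc i) k m \<and> aa x i m = aa x j m'))"
proof -
  have "aa x (Suc i) k = aa x (Suc j) l \<longleftrightarrow>
      rcset (acset {aa x i m | m. x (Suc i) k m}) = rcset (acset {aa x j m | m. x (Suc j) l m})"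
    by (simp add: rcset_inject)
  also have "\<dots> \<longleftrightarrow> {aa x i m | m. x (Suc i) k m} = {aa x j m | m. x (Suc j) l m}"
    unfolding rcset_aa_Suc ..
  also have "\<dots> \<longleftrightarrow> (\<forall>m. x (Suc i) k m \<longrightarrow> (\<exists>m'. x (Suc j) l m' \<and> aa x i m = aa x j m')) \<and>
    (\<forall>m'. x (Suc j) l m' \<longrightarrow> (\<exists>m. x (Suc i) k m \<and> aa x i m = aa x j m'))"
    by (rule setcompr_eq_iff)
  finally show ?thesis .
qed

text \<open>By induction on the rank, equality of coded sets is a countable Boolean combination of
  bits and of equalities one rank lower.\<close>

lemma pred_aa_eq [measurable]: "Measurable.pred (Xborel n) (\<lambda>x. aa x i k = aa x j l)"
proof (induction i arbitrary: j k l)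
  case 0
  show ?case
  proof (cases j)
    case 0
    have "Measurable.pred (Xborel n) (\<lambda>x. \<forall>m. x 0 k m = x 0 l m)" by measurable
    then show ?thesis using 0 by (simp add: fun_eq_iff)
  qed simp
next
  case (Suc i)
  note Suc.IH [measurable]
  show ?case
  proof (cases j)
    case (Suc j')
    show ?thesis unfolding Suc aa_Suc_eq_iff by measurable
  qed simp
qed

lemma pred_hmem [measurable]: "Measurable.pred (Xborel n) (\<lambda>x. hmem (aa x i k) (aa x j l))"
proof (cases j)
  case (Suc j')
  have eq: "hmem (aa x i k) (aa x (Suc j') l) \<longleftrightarrow> (\<exists>m. x (Suc j') l m \<and> aa x i k = aa x j' m)" for x
    unfolding aa.simps hmem.simps rcset_aa_Suc by blast
  show ?thesis unfolding Suc eq by measurable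
qed simp

lemma pred_pat [measurable]: "Measurable.pred (Xborel n) (\<lambda>x. pat (fst (denote x a)) (fst (denote x b)) = p)"
proof -
  have eq: "pat (fst (denote x a)) (fst (denote x b)) = p \<longleftrightarrow> length p = length (fst a) \<and>
     (\<forall>i<length (fst a). length (p ! i) = length (fst b) \<and> (\<forall>j<length (fst b).
        fst (p ! i ! j) = (aa x (fst (fst a ! i)) (snd (fst a ! i)) = aa x (fst (fst b ! j)) (snd (fst b ! j))) \<and>
        snd (p ! i ! j) = hmem (aa x (fst (fst a ! i)) (snd (fst a ! i))) (aa x (fst (fst b ! j)) (snd (fst b ! j)))))" for x
    by (auto simp: pat_def denote_def list_eq_iff_nth_eq prod_eq_iff)
  show ?thesis unfolding eq by measurable
qed

lemma pred_rel [measurable]: "Measurable.pred (Xborel n) (\<lambda>x. rel (denote x a) (denote x b))"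
proof -
  have eq: "rel (denote x a) (denote x b) \<longleftrightarrow> (\<exists>p. rel_code (snd a) (snd b) p \<and> pat (fst (denote x a)) (fst (denote x b)) = p)" for x
    by (simp add: rel_def denote_def)
  show ?thesis unfolding eq by measurable
qed

lemma pred_denote_eq [measurable]: "Measurable.pred (Xborel n) (\<lambda>x. denote x a = denote x b)"
proof -
  have eq: "denote x a = denote x b \<longleftrightarrow> snd a = snd b \<and> length (fst a) = length (fst b) \<and>
      (\<forall>i<length (fst a). aa x (fst (fst a ! i)) (snd (fst a ! i)) = aa x (fst (fst b ! i)) (snd (fst b ! i)))" for x
    by (auto simp: denote_def list_eq_iff_nth_eq)
  show ?thesis unfolding eq by measurable
qed

lemma pred_atom_bit [measurable]: "Measurable.pred (Xborel n) (\<lambda>x. atom_bit (aa x i k) j)"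
  by (cases i) (simp_all add: atom_bit_def)

lemma pred_elem_code [measurable]: "Measurable.pred (Xborel n) (\<lambda>x. elem_code (denote x a) b)"
proof -
  obtain tag i j where b: "from_nat b = (tag :: bool, i :: nat, j :: nat)"
    by (cases "from_nat b :: bool \<times> nat \<times> nat")
  have eq: "elem_code (denote x a) b \<longleftrightarrow> (if tag then i = length (fst a) \<and> j = snd a
      else i < length (fst a) \<and> atom_bit (aa x (fst (fst a ! i)) (snd (fst a ! i))) j)" for x
    by (cases tag) (auto simp: elem_code_def b denote_def)
  show ?thesis unfolding eq by measurable
qed

definition list_pt :: "(nat \<times> nat \<times> nat) list \<Rightarrow> pt" where
  "list_pt g i k m \<longleftrightarrow> (i, k, m) \<in> set g"

text \<open>\<open>forced\<close> may be arbitrarily complicated, but it sees finitely many bits; it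
  is thus a countable union over finite patterns, whatever \<open>W\<close> is.\<close>

lemma forced_iff_list_pt:
  "forced n W L y \<longleftrightarrow> (\<exists>g. forced n W L (list_pt g) \<and> (\<forall>i<L. \<forall>k<L. \<forall>m<L. y i k m = list_pt g i k m))"
proof
  assume f: "forced n W L y"
  have "finite {p \<in> {..<L} \<times> {..<L} \<times> {..<L}. y (fst p) (fst (snd p)) (snd (snd p))}" by simp
  then obtain g where "set g = {p \<in> {..<L} \<times> {..<L} \<times> {..<L}. y (fst p) (fst (snd p)) (snd (snd p))}"
    using finite_list by blast
  then have g: "\<forall>i<L. \<forall>k<L. \<forall>m<L. y i k m = list_pt g i k m" by (simp add: list_pt_def)
  then have "agree n L y (list_pt g)" by (simp add: agree_def)
  then show "\<exists>g. forced n W L (list_pt g) \<and> (\<forall>i<L. \<forall>k<L. \<forall>m<L. y i k m = list_pt g i k m)"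
    using forced_cong f g by blast
next
  assume "\<exists>g. forced n W L (list_pt g) \<and> (\<forall>i<L. \<forall>k<L. \<forall>m<L. y i k m = list_pt g i k m)"
  then obtain g where g: "forced n W L (list_pt g)" "\<forall>i<L. \<forall>k<L. \<forall>m<L. y i k m = list_pt g i k m" by blast
  then have "agree n L (list_pt g) y" by (simp add: agree_def)
  then show "forced n W L y" using g(1) by (rule forced_cong)
qed

lemma pred_forced:
  assumes [measurable]: "\<And>i k m. Measurable.pred M (\<lambda>x. y x i k m)"
  shows "Measurable.pred M (\<lambda>x. forced n W L (y x))"
proof -
  have eq: "(\<lambda>x. forced n W L (y x)) = (\<lambda>x. \<exists>g. forced n W L (list_pt g) \<and>
      (\<forall>i<L. \<forall>k<L. \<forall>m<L. y x i k m = list_pt g i k m))"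
    by (rule ext, rule forced_iff_list_pt)
  show ?thesis by (subst eq) measurable
qed

context generic_labels
begin

lemma pred_lab [measurable]: "Measurable.pred (Xborel n) (\<lambda>x. lab (denote x a) m)"
proof (cases "m < length (stem (snd a))")
  case True
  then show ?thesis by (simp add: lab_def overwrite_def denote_def)
next
  case False
  \<comment> \<open>By \<open>\<phi>_eq\<close> bit \<open>m\<close> sees \<open>Suc m\<close> bits
    of the code, so a quantifier over finite lists suffices.\<close>
  have eq: "lab (denote x a) m \<longleftrightarrow> (\<exists>l. \<psi> m l \<and> length l = Suc m \<and> (\<forall>j<Suc m. elem_code (denote x a) j = l ! j))" for x
  proof -
    have "lab (denote x a) m \<longleftrightarrow> \<psi> m (map (elem_code (denote x a)) [0..<Suc m])"
      using False by (simp add: lab_def overwrite_def denote_def \<phi>_eq del: upt_Suc)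
    also have "\<dots> \<longleftrightarrow> (\<exists>l. \<psi> m l \<and> map (elem_code (denote x a)) [0..<Suc m] = l)" by blast
    also have "\<dots> \<longleftrightarrow> (\<exists>l. \<psi> m l \<and> length l = Suc m \<and> (\<forall>j<Suc m. elem_code (denote x a) j = l ! j))"
      by (intro ex_cong1) (auto simp: list_eq_iff_nth_eq simp del: upt_Suc)
    finally show ?thesis .
  qed
  show ?thesis unfolding eq by measurable
qed

lemma pred_struct_pt: "Measurable.pred (Xborel n) (\<lambda>x. struct_pt (\<lambda>p. denote x (f p)) i k m)"
proof (cases i)
  case 0
  have eq: "(\<lambda>x. struct_pt (\<lambda>p. denote x (f p)) i k m) = (\<lambda>x. lab (denote x (f (0, k))) m)"
    by (rule ext) (simp add: struct_pt_def 0)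
  show ?thesis unfolding eq by (rule pred_lab)
next
  case (Suc j)
  have eq: "(\<lambda>x. struct_pt (\<lambda>p. denote x (f p)) i k m) = (\<lambda>x. rel (denote x (f (j, m))) (denote x (f (i, k))))"
    by (rule ext) (simp add: struct_pt_def Suc)
  show ?thesis unfolding eq by (rule pred_rel)
qed

lemma pred_step_ok: "Measurable.pred (Xborel n) (\<lambda>x. step_ok t x s s')"
proof -
  obtain i a where t: "from_nat t = (i :: nat, a :: name)" by (cases "from_nat t :: nat \<times> name")
  have [measurable]: "Measurable.pred (Xborel n) (\<lambda>x. forced n (D t) (fst s') (struct_pt (\<lambda>p. denote x (name_at s' p))))"
    by (rule pred_forced) (rule pred_struct_pt)
  show ?thesis unfolding step_ok_def state_ok_def t prod.case by measurable
qed

text \<open>The previous code takes countably many values, so it can be treated as fixed; the least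
  witness of measurable predicates is measurable.\<close>

lemma measurable_stage_code [measurable]: "stage_code t \<in> measurable (Xborel n) (count_space UNIV)"
proof (induction t)
  case 0
  have eq: "stage_code 0 = (\<lambda>x. to_nat ((0, []) :: state))" by (rule ext) simp
  show ?case unfolding eq by (rule measurable_count_space_const)
next
  case (Suc t)
  have "(\<lambda>x. step_ok t x (from_nat (stage_code t x)) (from_nat e)) \<in> measurable (Xborel n) (count_space UNIV)" for e
    by (rule measurable_compose_countable[where f = "\<lambda>s x. step_ok t x (from_nat s) (from_nat e)" and g = "stage_code t"])
      (rule pred_step_ok, rule Suc)
  then have "(\<lambda>x. LEAST e. step_ok t x (from_nat (stage_code t x)) (from_nat e)) \<in> measurable (Xborel n) (count_space UNIV)"
    by (rule measurable_Least)
  moreover have "stage_code (Suc t) = (\<lambda>x. LEAST e. step_ok t x (from_nat (stage_code t x)) (from_nat e))"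
    by (rule ext) simp
  ultimately show ?case by (simp only:)
qed

lemma measurable_enum_name [measurable]: "(\<lambda>x. enum_name x p) \<in> measurable (Xborel n) (count_space UNIV)"
  unfolding enum_name_def stage_def by (rule measurable_compose[OF measurable_stage_code]) simp

lemma pred_generic_pt: "Measurable.pred (Xborel n) (\<lambda>x. generic_pt x i k m)"
proof -
  have "Measurable.pred (Xborel n) (\<lambda>x. struct_pt (enum x) i k m)"
  proof (cases i)
    case 0
    have eq: "(\<lambda>x. struct_pt (enum x) i k m) = (\<lambda>x. lab (denote x (enum_name x (0, k))) m)"
      by (rule ext) (simp add: struct_pt_def enum_def 0)
    show ?thesis unfolding eq
      by (rule measurable_compose_countable[where f = "\<lambda>a x. lab (denote x a) m" and g = "\<lambda>x. enum_name x (0, k)"])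
        (rule pred_lab, rule measurable_enum_name)
  next
    case (Suc j)
    have eq: "(\<lambda>x. struct_pt (enum x) i k m) = (\<lambda>x. rel (denote x (enum_name x (j, m))) (denote x (enum_name x (i, k))))"
      by (rule ext) (simp add: struct_pt_def enum_def Suc)
    have "Measurable.pred (Xborel n) (\<lambda>x. rel (denote x (enum_name x (j, m))) (denote x b))" for b
      by (rule measurable_compose_countable[where f = "\<lambda>a x. rel (denote x a) (denote x b)" and g = "\<lambda>x. enum_name x (j, m)"])
        (rule pred_rel, rule measurable_enum_name)
    then show ?thesis unfolding eq
      by (rule measurable_compose_countable[where f = "\<lambda>b x. rel (denote x (enum_name x (j, m))) (denote x b)"
          and g = "\<lambda>x. enum_name x (i, k)"]) (rule measurable_enum_name)
  qed
  then show ?thesis by (cases "enat i < n") (simp_all add: generic_pt_def)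
qed

lemma generic_pt_borel:
  assumes "openin (Xtop n) W"
  shows "{x \<in> Xset n. generic_pt x \<in> W} \<in> borel_sets_of (Xtop n)"
proof -
  \<comment> \<open>An open set is a union of cylinders, so membership of a point of
    \<open>Xset n\<close> is forced by a finite cube.\<close>
  have "generic_pt x \<in> W \<longleftrightarrow> (\<exists>L. forced n W L (generic_pt x))" for x
  proof
    assume "generic_pt x \<in> W"
    then show "\<exists>L. forced n W L (generic_pt x)"
      using openin_Xtop_nbhd[OF assms] unfolding forced_def by blast
  next
    assume "\<exists>L. forced n W L (generic_pt x)"
    then show "generic_pt x \<in> W" using generic_pt_in_Xset by (auto simp: forced_def agree_def)
  qed
  moreover have "Measurable.pred (Xborel n) (\<lambda>x. \<exists>L. forced n W L (generic_pt x))"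
    using pred_forced[OF pred_generic_pt] by measurable
  ultimately have "Measurable.pred (Xborel n) (\<lambda>x. generic_pt x \<in> W)" by simp
  then show ?thesis by (simp add: pred_def sets_Xborel)
qed

lemma generic_pt_borel_reduction:
  assumes "1 \<le> n" and C: "\<And>y. y \<in> Xset n \<Longrightarrow> \<forall>t. \<exists>L. forced n (D t) L y \<Longrightarrow> y \<in> C"
  shows "borel_reducible (Xtop n) (FF n) (subtopology (Xtop n) C) (FF n)"
proof -
  have in_C: "generic_pt x \<in> C" for x using generic_pt_in_Xset generic_pt_forced by (intro C) auto
  have "{x \<in> topspace (Xtop n). generic_pt x \<in> U} \<in> borel_sets_of (Xtop n)" if U: "openin (subtopology (Xtop n) C) U" for U
  proof -
    obtain W where W: "openin (Xtop n) W" "U = W \<inter> C" using U unfolding openin_subtopology by blast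
    then have "{x \<in> topspace (Xtop n). generic_pt x \<in> U} = {x \<in> Xset n. generic_pt x \<in> W}" using in_C by auto
    then show ?thesis using generic_pt_borel[OF W(1)] by simp
  qed
  then have "borel_map (Xtop n) (subtopology (Xtop n) C) generic_pt"
    using in_C generic_pt_in_Xset by (auto simp: borel_map_def)
  then show ?thesis using generic_pt_reduces[OF assms(1)] by (auto simp: borel_reducible_def)
qed

end

theorem theorem5p1:
  fixes n :: enat and C :: "pt set"
  assumes "1 \<le> n"
    and "comeager_in (Xtop n) C"
  shows "borel_reducible (Xtop n) (FF n) (subtopology (Xtop n) C) (FF n)"
proof -
  obtain D :: "nat \<Rightarrow> pt set"
    where D: "\<And>t L y. \<exists>L'\<ge>L. \<exists>y'. agree n L y y' \<and> forced n (D t) L' y'"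
      and C: "\<And>y. y \<in> Xset n \<Longrightarrow> \<forall>t. \<exists>L. forced n (D t) L y \<Longrightarrow> y \<in> C"
    using comeager_forced[OF assms(2)] by blast
  obtain \<phi> \<psi> where "generic_labels n D \<phi> \<psi>" using generic_labels_exist[where D = D, OF D] by blast
  then interpret generic_labels n D \<phi> \<psi> .
  show ?thesis using assms(1) C by (rule generic_pt_borel_reduction)
qed

end
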